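(* There exist $2^{\mathfrak{c}}$ distinct extension operators on the set $T[\mathbb{R},\mathbb{R}]$ of all functions $f:\mathbb{R}\to\mathbb{R}$.
   Context: $\mathbf{No}$ is Conway's field of surreal numbers with the surreal exponential; $\mathfrak{c}=2^{\aleph_0}$. $T[\mathbf{No}]$ is the class of functions whose domain is an interval of $\mathbf{No}$ with values in $\mathbf{No}$. For a real interval $I$, $I^*$ is the corresponding surreal interval (so $\mathbb{R}^*=\mathbf{No}$); $F\in T[\mathbf{No}]$ extends $f$ if $F=f$ on $\mathrm{dom}(f)$ and $\mathrm{dom}(F)=\mathrm{dom}(f)^*$. An extension operator on $K\subseteq T[\mathbb{R},\mathbb{R}]$ is a map $\mathsf{E}:K\to T[\mathbf{No}]$ such that for all $f,g\in K$, $\lambda\in\mathbb{R}$: (i) $\mathsf{E}(f)$ extends $f$; (ii) $\mathsf{E}(\lambda f)=\lambda\mathsf{E}(f)$, $\mathsf{E}(f+g)=\mathsf{E}(f)+\mathsf{E}(g)$; (iii) if $f$ is the real monomial $x^n$, $n\in\mathbb{N}$, then $\mathsf{E}(f)$ is the surreal monomial $x^n$ on $\mathrm{dom}(f)^*$; (iv) if $f$ is the real exponential then $\mathsf{E}(f)$ is the surreal exponential on $\mathrm{dom}(f)^*$. *)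

theory Defs
  imports Complex_Main "HOL-Library.Equipollence" "HOL-Library.Infinite_Typeclass"
begin

section \<open>Ordinals\<close>

text \<open>
  The surreal numbers form a proper class, so no single HOL type contains all of them. The
  class of all ordinals is therefore represented by a well-ordered type about which we assume
  what set theory provides for it: some limit ordinal exists, and a function defined on the
  ordinals below a given one (that is, on a set) has bounded range. The class of ordinals of
  any universe of sets is of this form. Nothing corresponding to the power set axiom is assumed,
  so everything below holds more generally, with ``small'' meaning indexed by the ordinals
  below some element of the type.
\<close>

class ordinals = wellorder +
  assumes infinity: "\<exists>l. (\<exists>i. i < l) \<and> (\<forall>i<l. \<exists>j<l. i < j)"
    and replacement: "\<And>a f. \<exists>b. \<forall>i<a. f i < b"

text \<open>
  The assumptions are satisfiable: the initial ordinal of the successor cardinal of any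
  infinite type is an instance.
\<close>

unbundle cardinal_syntax

definition suc_rel :: "'a::infinite suc rel" where
  "suc_rel = card_suc |UNIV :: 'a set|"

lemma suc_rel:
  shows "Card_order (suc_rel :: 'a::infinite suc rel)"
    and "Field (suc_rel :: 'a suc rel) = UNIV"
    and "regularCard (suc_rel :: 'a suc rel)"
    and "infinite (UNIV :: 'a suc set)"
    and "|UNIV :: 'a set| <o (suc_rel :: 'a suc rel)"
proof -
  note suc_rel_def [simp]
  have c: "card_order |UNIV :: 'a set|" by (simp add: card_of_card_order_on)
  have C: "Cinfinite |UNIV :: 'a set|"
    by (simp add: cinfinite_def infinite_UNIV card_of_card_order_on Field_card_of)
  show 1: "Card_order (suc_rel::'a suc rel)" using Cinfinite_card_suc[OF C c] by simp
  show 2: "Field (suc_rel::'a suc rel) = UNIV" by (simp add: Field_card_suc)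
  show "regularCard (suc_rel::'a suc rel)" using regularCard_card_suc[OF c C] by simp
  show "infinite (UNIV :: 'a suc set)"
    using Cinfinite_card_suc[OF C c] 2 by (simp add: cinfinite_def)
  show "|UNIV :: 'a set| <o (suc_rel :: 'a suc rel)" using card_suc_greater[OF c] by simp
qed

instantiation suc :: (infinite) ordinals
begin

definition less_eq_suc :: "'a suc \<Rightarrow> 'a suc \<Rightarrow> bool" where
  "x \<le> y \<longleftrightarrow> (x, y) \<in> suc_rel"

definition less_suc :: "'a suc \<Rightarrow> 'a suc \<Rightarrow> bool" where
  "x < y \<longleftrightarrow> (x, y) \<in> suc_rel \<and> x \<noteq> y"

instance
proof
  note sr = suc_rel[where 'a='a]
  have W: "Well_order (suc_rel :: 'a suc rel)" using sr(1) unfolding card_order_on_def by blast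
  then have L: "refl (suc_rel :: 'a suc rel)" "trans (suc_rel :: 'a suc rel)" "antisym (suc_rel :: 'a suc rel)"
    "total (suc_rel :: 'a suc rel)" "wf ((suc_rel :: 'a suc rel) - Id)"
    by (simp_all add: sr(2) order_on_defs)
  fix x y z :: "'a suc"
  show "(x < y) = (x \<le> y \<and> \<not> y \<le> x)"
    using L by (auto simp: less_suc_def less_eq_suc_def dest: antisymD)
  show "x \<le> x" using L by (auto simp: less_eq_suc_def dest: reflD)
  show "x \<le> y \<Longrightarrow> y \<le> z \<Longrightarrow> x \<le> z"
    using L by (auto simp: less_eq_suc_def dest: transD)
  show "x \<le> y \<Longrightarrow> y \<le> x \<Longrightarrow> x = y"
    using L by (auto simp: less_eq_suc_def dest: antisymD)
  show "x \<le> y \<or> y \<le> x" using L by (metis UNIV_I less_eq_suc_def reflD total_on_def)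
  show "P a" if "\<And>x. (\<And>y. y < x \<Longrightarrow> P y) \<Longrightarrow> P x" for P and a :: "'a suc"
    using L(5) by (rule wf_induct_rule) (use that in \<open>auto simp: less_suc_def\<close>)
  have bnd: "\<exists>b. \<forall>k\<in>K. (k, b) \<in> suc_rel \<and> k \<noteq> b"
    if "|K| <o (suc_rel::'a suc rel)" for K :: "'a suc set"
  proof -
    have "\<not> cofinal K suc_rel"
      using sr(2,3) that unfolding regularCard_def by (metis not_ordLess_ordIso top_greatest)
    then obtain a where a: "\<forall>k\<in>K. a = k \<or> (a, k) \<notin> suc_rel"
      by (auto simp: cofinal_def sr(2))
    obtain b where "a \<noteq> b" "(a, b) \<in> suc_rel"
      using infinite_Card_order_limit[OF sr(1), of a] sr(2,4) by auto
    then show ?thesis using a L by (metis UNIV_I antisymD total_on_def transD)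
  qed
  show rep: "\<exists>b. \<forall>i<a. f i < b" for a and f :: "'a suc \<Rightarrow> 'a suc"
  proof -
    have "|underS suc_rel a| <o (suc_rel::'a suc rel)"
      using sr(1) by (rule card_of_underS) (simp add: sr(2))
    then have "|f ` underS suc_rel a| <o (suc_rel::'a suc rel)"
      using card_of_image ordLeq_ordLess_trans by blast
    from bnd[OF this] show ?thesis by (auto simp: less_suc_def underS_def)
  qed
  show "\<exists>l::'a suc. (\<exists>i. i < l) \<and> (\<forall>i<l. \<exists>j<l. i < j)"
  proof -
    have up: "\<exists>j. i < j" for i :: "'a suc"
      using infinite_Card_order_limit[OF sr(1), of i] sr(2,4) by (auto simp: less_suc_def)
    define s where "s = (\<lambda>i::'a suc. SOME j. i < j)"
    have s: "i < s i" for i unfolding s_def using up by (rule someI_ex)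
    define g where "g = (\<lambda>n. (s ^^ n) undefined)"
    have "|range g| \<le>o |UNIV :: nat set|" by (rule card_of_image)
    also have "|UNIV :: nat set| \<le>o |UNIV :: 'a set|"
      using infinite_UNIV infinite_iff_card_of_nat by blast
    finally have "|range g| <o (suc_rel::'a suc rel)" using sr(5) ordLeq_ordLess_trans by blast
    from bnd[OF this] have ex: "\<exists>b. \<forall>n. g n < b" by (auto simp: less_suc_def)
    define R where "R = (suc_rel::'a suc rel) - Id"
    from ex obtain b where b: "b \<in> {b. \<forall>n. g n < b}" by blast
    obtain l where l0: "l \<in> {b. \<forall>n. g n < b}"
      and l1: "\<And>y. (y, l) \<in> suc_rel - Id \<Longrightarrow> y \<notin> {b. \<forall>n. g n < b}"
      using wfE_min[OF L(5) b] by blast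
    from l0 have l: "\<forall>n. g n < l" by simp
    have lm: "\<not> (\<forall>n. g n < y)" if "(y, l) \<in> R" for y using l1 that by (auto simp: R_def)
    have "\<exists>j<l. i < j" if il: "i < l" for i
    proof -
      from lm[of i] il obtain n where "\<not> g n < i" by (auto simp: R_def less_suc_def)
      then have "i = g n \<or> i < g n" using L(4) by (auto simp: less_suc_def total_on_def)
      moreover have "g n < g (Suc n)" using s by (simp add: g_def)
      ultimately have "i < g n \<or> i < g (Suc n)" by auto
      then show ?thesis using l by blast
    qed
    then show ?thesis using l by blast
  qed
qed

end

unbundle no cardinal_syntax


section \<open>Surreal numbers\<close>

text \<open>
  A surreal number is a map from an ordinal to the signs $+$ and $-$. The signs are
  represented by 1 and -1, and the value 0 stands for ``undefined''; with this convention the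
  lexicographic order of sign expansions is the one in which $-$ < undefined < $+$.
\<close>

typedef (overloaded) 'o surreal =
  "{s :: 'o::ordinals \<Rightarrow> int. range s \<subseteq> {-1, 0, 1} \<and> (\<exists>a. {i. s i \<noteq> 0} = {..<a})}"
  morphisms sign Surreal
proof
  have "{..<(LEAST i::'o. True)} = {}"
    by (auto dest: not_less_Least)
  then show "(\<lambda>_. 0) \<in> {s :: 'o \<Rightarrow> int. range s \<subseteq> {-1, 0, 1} \<and> (\<exists>a. {i. s i \<noteq> 0} = {..<a})}"
    by auto
qed

definition birthday :: "'o::ordinals surreal \<Rightarrow> 'o" where
  "birthday x = (THE a. {i. sign x i \<noteq> 0} = {..<a})"

text \<open>\<open>simpler x y\<close>: the sign expansion of \<open>x\<close> is a proper initial segment of that of \<open>y\<close>.\<close>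

definition simpler :: "'o::ordinals surreal \<Rightarrow> 'o surreal \<Rightarrow> bool" where
  "simpler x y \<longleftrightarrow> birthday x < birthday y \<and> (\<forall>i<birthday x. sign x i = sign y i)"

instantiation surreal :: (ordinals) ord
begin

definition less_surreal :: "'a surreal \<Rightarrow> 'a surreal \<Rightarrow> bool" where
  "x < y \<longleftrightarrow> (\<exists>a. (\<forall>i<a. sign x i = sign y i) \<and> sign x a < sign y a)"

definition less_eq_surreal :: "'a surreal \<Rightarrow> 'a surreal \<Rightarrow> bool" where
  "x \<le> y \<longleftrightarrow> x < y \<or> x = y" for x y :: "'a surreal"

instance ..

end

text \<open>
  \<open>cut L R\<close> is the number usually written $\{L \mid R\}$. It exists whenever \<open>L\<close> and \<open>R\<close> are
  small and every element of \<open>L\<close> is less than every element of \<open>R\<close>.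
\<close>

definition cut :: "'o::ordinals surreal set \<Rightarrow> 'o surreal set \<Rightarrow> 'o surreal" where
  "cut L R = (THE x. (\<forall>l\<in>L. l < x) \<and> (\<forall>r\<in>R. x < r) \<and>
     (\<forall>y. (\<forall>l\<in>L. l < y) \<and> (\<forall>r\<in>R. y < r) \<longrightarrow> y = x \<or> simpler x y))"

definition lopt :: "'o::ordinals surreal \<Rightarrow> 'o surreal set" where
  "lopt x = {y. simpler y x \<and> y < x}"

definition ropt :: "'o::ordinals surreal \<Rightarrow> 'o surreal set" where
  "ropt x = {y. simpler y x \<and> x < y}"

lemma lopt_birthday: "u \<in> lopt x \<Longrightarrow> birthday u < birthday x"
  and ropt_birthday: "u \<in> ropt x \<Longrightarrow> birthday u < birthday x"
  by (auto simp: lopt_def ropt_def simpler_def)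


subsection \<open>Field operations\<close>

instantiation surreal :: (ordinals) "{zero, one, plus, uminus, minus}"
begin

definition zero_surreal :: "'a surreal" where
  "0 = cut {} {}"

definition one_surreal :: "'a surreal" where
  "1 = cut {0} {}"

function plus_surreal :: "'a surreal \<Rightarrow> 'a surreal \<Rightarrow> 'a surreal" where
  "plus_surreal x y =
     cut ((\<lambda>u. plus_surreal u y) ` lopt x \<union> (\<lambda>v. plus_surreal x v) ` lopt y)
         ((\<lambda>u. plus_surreal u y) ` ropt x \<union> (\<lambda>v. plus_surreal x v) ` ropt y)"
  by pat_completeness auto
termination
  by (relation "inv_image ({(a, b). a < b} <*lex*> {(a, b). a < b})
        (\<lambda>(x, y). (birthday x, birthday y))")
    (auto simp: wf lopt_birthday ropt_birthday)

declare plus_surreal.simps [simp del]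

definition uminus_surreal :: "'a surreal \<Rightarrow> 'a surreal" where
  "- x = Surreal (\<lambda>i. - sign x i)"

definition minus_surreal :: "'a surreal \<Rightarrow> 'a surreal \<Rightarrow> 'a surreal" where
  "x - y = x + (- y)" for x y :: "'a surreal"

instance ..

end

instantiation surreal :: (ordinals) times
begin

function times_surreal :: "'a surreal \<Rightarrow> 'a surreal \<Rightarrow> 'a surreal" where
  "times_surreal x y =
     cut ((\<lambda>(u, v). times_surreal u y + times_surreal x v - times_surreal u v) `
            (lopt x \<times> lopt y \<union> ropt x \<times> ropt y))
         ((\<lambda>(u, v). times_surreal u y + times_surreal x v - times_surreal u v) `
            (lopt x \<times> ropt y \<union> ropt x \<times> lopt y))"
  by pat_completeness auto
termination
  by (relation "inv_image ({(a, b). a < b} <*lex*> {(a, b). a < b})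
        (\<lambda>(x, y). (birthday x, birthday y))")
    (auto simp: wf lopt_birthday ropt_birthday)

declare times_surreal.simps [simp del]

instance ..

end

instance surreal :: (ordinals) power ..

instantiation surreal :: (ordinals) inverse
begin

definition inverse_surreal :: "'a surreal \<Rightarrow> 'a surreal" where
  "inverse x = (if x = 0 then 0 else (THE y. x * y = 1))" for x :: "'a surreal"

definition divide_surreal :: "'a surreal \<Rightarrow> 'a surreal \<Rightarrow> 'a surreal" where
  "divide_surreal x y = x * inverse y"

instance ..

end


subsection \<open>Real numbers as surreal numbers\<close>

primrec surreal_of_nat :: "nat \<Rightarrow> 'o::ordinals surreal" where
  "surreal_of_nat 0 = 0"
| "surreal_of_nat (Suc n) = surreal_of_nat n + 1"

definition surreal_of_int :: "int \<Rightarrow> 'o::ordinals surreal" where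
  "surreal_of_int k =
     (if 0 \<le> k then surreal_of_nat (nat k) else - surreal_of_nat (nat (- k)))"

definition surreal_of_real :: "real \<Rightarrow> 'o::ordinals surreal" where
  "surreal_of_real r =
     cut {surreal_of_int k / surreal_of_nat 2 ^ n | k n. of_int k / 2 ^ n < r}
         {surreal_of_int k / surreal_of_nat 2 ^ n | k n. r < of_int k / 2 ^ n}"


subsection \<open>The exponential function\<close>

primrec exp_poly :: "nat \<Rightarrow> 'o::ordinals surreal \<Rightarrow> 'o surreal" where
  "exp_poly 0 x = 1"
| "exp_poly (Suc n) x = exp_poly n x + x ^ Suc n / surreal_of_nat (fact (Suc n))"

text \<open>
  This is the Kruskal--Gonshor exponential,
  \[ \exp x = \{0, \exp x^L \cdot [x - x^L]_n, \exp x^R \cdot [x - x^R]_{2n+1} \mid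
       \exp x^R / [x^R - x]_n, \exp x^L / [x^L - x]_{2n+1}\}, \]
  where $[y]_n$ is the $n$-th Taylor polynomial of the exponential function. A term
  containing some $[y]_{2n+1}$ (these have $y < 0$) is by convention present only if
  $[y]_{2n+1} > 0$.
\<close>

function surreal_exp :: "'o::ordinals surreal \<Rightarrow> 'o surreal" where
  "surreal_exp x =
     cut ({0}
          \<union> (\<Union>u\<in>lopt x. {surreal_exp u * exp_poly n (x - u) | n. True})
          \<union> (\<Union>v\<in>ropt x. {surreal_exp v * exp_poly (2 * n + 1) (x - v) | n.
                           0 < exp_poly (2 * n + 1) (x - v)}))
         ((\<Union>v\<in>ropt x. {surreal_exp v / exp_poly n (v - x) | n. True})
          \<union> (\<Union>u\<in>lopt x. {surreal_exp u / exp_poly (2 * n + 1) (u - x) | n.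
                           0 < exp_poly (2 * n + 1) (u - x)}))"
  by pat_completeness auto
termination
  by (relation "inv_image {(a, b). a < b} birthday")
    (auto simp: wf lopt_birthday ropt_birthday)

declare surreal_exp.simps [simp del]


section \<open>Extension operators\<close>

text \<open>
  Every function considered here has domain $\mathbb{R}$. A function extending it has as its
  domain the corresponding surreal interval, which is the whole of $\mathbf{No}$, so it is a
  total function on the type of surreal numbers.
\<close>

definition extends :: "('o::ordinals surreal \<Rightarrow> 'o surreal) \<Rightarrow> (real \<Rightarrow> real) \<Rightarrow> bool" where
  "extends F f \<longleftrightarrow> (\<forall>r. F (surreal_of_real r) = surreal_of_real (f r))"

definition extension_operator ::
  "(real \<Rightarrow> real) set \<Rightarrow> ((real \<Rightarrow> real) \<Rightarrow> 'o::ordinals surreal \<Rightarrow> 'o surreal) \<Rightarrow> bool" where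
  "extension_operator K E \<longleftrightarrow>
     (\<forall>f\<in>K. extends (E f) f) \<and>
     (\<forall>f\<in>K. \<forall>c. (\<lambda>x. c * f x) \<in> K \<longrightarrow>
        E (\<lambda>x. c * f x) = (\<lambda>x. surreal_of_real c * E f x)) \<and>
     (\<forall>f\<in>K. \<forall>g\<in>K. (\<lambda>x. f x + g x) \<in> K \<longrightarrow> E (\<lambda>x. f x + g x) = (\<lambda>x. E f x + E g x)) \<and>
     (\<forall>n. (\<lambda>x. x ^ n) \<in> K \<longrightarrow> E (\<lambda>x. x ^ n) = (\<lambda>x. x ^ n)) \<and>
     (exp \<in> K \<longrightarrow> E exp = surreal_exp)"

end

theory Submission
  imports Defs "HOL-Library.Function_Algebras"
begin

text \<open>
  The surreal numbers are a vector space over the reals, so an extension operator may be defined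
  separately at every argument \<open>x\<close>. If \<open>x\<close> is real, the value at \<open>f\<close> has to be \<open>f x\<close>, and this is
  compatible with the other requirements because real powers and exponentials agree with the surreal
  ones. If \<open>x\<close> is not real, any real-linear map with the right values at the monomials and at the
  exponential function will do. Together with the indicator functions of the points of $\mathbb{R}$
  these are linearly independent, so there is such a map for every choice of values in $\{0, 1\}$ at
  the indicator functions; the choices correspond to the subsets of $\mathbb{R}$.

  The order and ring laws are proved by Conway's inductions. Since numbers are sign expansions,
  equality is literal, and monotonicity has to be checked only between a number and its options.
  The exponential of a real number is real because all options of a real number are dyadic
  rationals, for which its defining cut consists of real numbers that converge to the usual value.
\<close>

section \<open>Sign expansions\<close>

text \<open>The freedom comes from the fact that extending a function prescribes values at real
  arguments alone. One non-real number suffices to tell the operators apart, and omega, the cut of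
  the naturals against nothing, is one. The obstacle is that the operations are bare recursions
  through \<open>cut\<close>, a definite description: nothing can be calculated before the cuts are
  known to exist. Hence \<open>is_cut\<close>, a local characterization of the value of a cut, and
  for sums and products the theorem that the recursion may be fed with arbitrary cut representations
  of the arguments; identities then follow by comparing options. Division is a definite description
  too. It is evaluated by exhibiting inverses, first of the powers of 2 by repeated halving, then of
  every nonzero real. At a non-real argument the exponential enters only as a number prescribed at a
  basis vector, so its recursion is analysed at real arguments, where all options are real.\<close>

lemma sign_range: "sign x i \<in> {-1, 0, 1}"
  using sign[of x] by blast

lemma sign_support_ex1: "\<exists>!a. {i. sign x i \<noteq> 0} = {..<a}"
  using sign[of x] by auto

lemma sign_nonzero_iff: "sign x i \<noteq> 0 \<longleftrightarrow> i < birthday x"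
  using theI'[OF sign_support_ex1[of x]] unfolding birthday_def by blast

lemma sign_eq_0_iff: "sign x i = 0 \<longleftrightarrow> birthday x \<le> i"
  using sign_nonzero_iff[of x i] by auto

lemma sign_cases:
  obtains "sign x i = -1" "i < birthday x" | "sign x i = 0" "birthday x \<le> i"
  | "sign x i = 1" "i < birthday x"
  using sign_range[of x i] sign_nonzero_iff[of x i] by fastforce

lemma surreal_eqI: "(\<And>i. sign x i = sign y i) \<Longrightarrow> x = y"
  by (metis sign_inject ext)

text \<open>The bound excludes \<open>UNIV\<close>, which is closed downwards but not of this form
  since there is no greatest ordinal. This is why \<open>sign_Surreal\<close> asks for a bound on
  the support.\<close>

lemma down_closed_bounded_eq_lessThan:
  fixes A :: "'o::wellorder set"
  assumes "\<And>i j. i < j \<Longrightarrow> j \<in> A \<Longrightarrow> i \<in> A" and "\<And>i. i \<in> A \<Longrightarrow> i < b"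
  shows "\<exists>a. A = {..<a}"
proof -
  have "b \<notin> A" using assms(2) by blast
  then have "(LEAST a. a \<notin> A) \<notin> A" by (rule LeastI)
  then have "A = {..<(LEAST a. a \<notin> A)}"
    using assms(1) by (auto dest: not_less_Least) (metis linorder_neqE)
  then show ?thesis by blast
qed

lemma sign_Surreal:
  assumes "\<And>i. s i \<in> {-1, 0, 1}" and "\<And>i j. i < j \<Longrightarrow> s j \<noteq> 0 \<Longrightarrow> s i \<noteq> 0"
    and "\<And>i. s i \<noteq> 0 \<Longrightarrow> i < b"
  shows "sign (Surreal s) = s"
proof -
  have "\<exists>a. {i. s i \<noteq> 0} = {..<a}"
    by (rule down_closed_bounded_eq_lessThan) (use assms in auto)
  then show ?thesis using assms(1) by (intro Surreal_inverse) auto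
qed

text \<open>Initial segments of a sign expansion, indexed by their length: simplicity becomes a
  statement about ordinals, and the options of a number become an image of a set of
  ordinals.\<close>

definition restr :: "'o::ordinals surreal \<Rightarrow> 'o \<Rightarrow> 'o surreal" where
  "restr x a = Surreal (\<lambda>i. if i < a then sign x i else 0)"

lemma sign_restr: "sign (restr x a) i = (if i < a then sign x i else 0)"
proof -
  have "sign (restr x a) = (\<lambda>i. if i < a then sign x i else 0)"
    unfolding restr_def
    by (rule sign_Surreal[where b = "birthday x"])
       (use sign_range[of x] in \<open>auto simp: sign_eq_0_iff split: if_splits\<close>)
  then show ?thesis by simp
qed

lemma less_birthday_restr: "i < birthday (restr x a) \<longleftrightarrow> i < a \<and> i < birthday x"
  by (metis sign_nonzero_iff sign_restr)

lemma birthday_restr: "birthday (restr x a) = min a (birthday x)"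
  by (rule linorder_cases[of "birthday (restr x a)" "min a (birthday x)"])
     (use less_birthday_restr[of _ x a] min_less_iff_conj in blast)+

lemma restr_self: "birthday x \<le> a \<Longrightarrow> restr x a = x"
  by (rule surreal_eqI) (auto simp: sign_restr sign_eq_0_iff)

lemma restr_restr: "a \<le> b \<Longrightarrow> restr (restr x b) a = restr x a"
  by (rule surreal_eqI) (auto simp: sign_restr)

lemma restr_eqI: "(\<And>i. i < a \<Longrightarrow> sign x i = sign y i) \<Longrightarrow> restr x a = restr y a"
  by (rule surreal_eqI) (auto simp: sign_restr)

lemma simpler_restr: "a < birthday x \<Longrightarrow> simpler (restr x a) x"
  by (auto simp: simpler_def birthday_restr sign_restr)

lemma simpler_iff_restr: "simpler y x \<longleftrightarrow> (\<exists>a<birthday x. y = restr x a)"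
proof
  assume "simpler y x"
  then have "y = restr x (birthday y)" "birthday y < birthday x"
    by (auto simp: simpler_def intro!: surreal_eqI) (auto simp: sign_restr sign_eq_0_iff)
  then show "\<exists>a<birthday x. y = restr x a" by blast
qed (auto intro: simpler_restr)

lemma simpler_birthday: "simpler y x \<Longrightarrow> birthday y < birthday x"
  by (simp add: simpler_def)

lemma not_simpler_self: "\<not> simpler x x"
  by (simp add: simpler_def)

lemma simpler_asym: "simpler x y \<Longrightarrow> \<not> simpler y x"
  by (auto simp: simpler_def)

lemma simpler_linear: "simpler u x \<Longrightarrow> simpler v x \<Longrightarrow> simpler u v \<or> u = v \<or> simpler v u"
  by (rule linorder_cases[of "birthday u" "birthday v"])
     (auto simp: simpler_def sign_eq_0_iff intro!: surreal_eqI, metis linorder_not_le sign_eq_0_iff)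


subsection \<open>The order\<close>

lemma surreal_less_irrefl: "\<not> (x::'o::ordinals surreal) < x"
  by (simp add: less_surreal_def)

lemma surreal_less_trans: "(x::'o::ordinals surreal) < y \<Longrightarrow> y < z \<Longrightarrow> x < z"
  unfolding less_surreal_def
proof (elim exE conjE)
  fix a b
  assume *: "\<forall>i<a. sign x i = sign y i" "sign x a < sign y a"
    "\<forall>i<b. sign y i = sign z i" "sign y b < sign z b"
  show "\<exists>a. (\<forall>i<a. sign x i = sign z i) \<and> sign x a < sign z a"
    by (rule exI[of _ "min a b"]) (use * in \<open>cases a b rule: linorder_cases; auto\<close>)
qed

lemma first_difference:
  fixes x y :: "'o::ordinals surreal"
  assumes "x \<noteq> y"
  obtains a where "\<And>i. i < a \<Longrightarrow> sign x i = sign y i" "sign x a \<noteq> sign y a"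
proof -
  obtain i where i: "sign x i \<noteq> sign y i" using assms surreal_eqI by blast
  show ?thesis
    by (rule that[of "LEAST i. sign x i \<noteq> sign y i"]) (use LeastI[of "\<lambda>i. sign x i \<noteq> sign y i", OF i] in \<open>auto dest: not_less_Least\<close>)
qed

lemma surreal_less_linear: "(x::'o::ordinals surreal) < y \<or> x = y \<or> y < x"
proof (rule ccontr)
  assume *: "\<not> ?thesis"
  then obtain a where "\<And>i. i < a \<Longrightarrow> sign x i = sign y i" "sign x a \<noteq> sign y a"
    using first_difference by blast
  then have "(\<forall>i<a. sign x i = sign y i) \<and> (\<forall>i<a. sign y i = sign x i)"
    "sign x a < sign y a \<or> sign y a < sign x a" by auto
  then have "x < y \<or> y < x" unfolding less_surreal_def by blast
  with * show False by blast
qed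

lemma less_iff_first_difference:
  fixes x y :: "'o::ordinals surreal"
  assumes "\<forall>i<a. sign x i = sign y i" "sign x a \<noteq> sign y a"
  shows "x < y \<longleftrightarrow> sign x a < sign y a"
proof
  assume "x < y"
  then obtain b where b: "\<forall>i<b. sign x i = sign y i" "sign x b < sign y b"
    by (auto simp: less_surreal_def)
  have "a = b" using assms b by (cases a b rule: linorder_cases) auto
  with b show "sign x a < sign y a" by simp
qed (use assms in \<open>auto simp: less_surreal_def\<close>)

instance surreal :: (ordinals) linorder
proof
  fix x y z :: "'a surreal"
  show "x < y \<longleftrightarrow> x \<le> y \<and> \<not> y \<le> x"
    using surreal_less_irrefl surreal_less_trans by (auto simp: less_eq_surreal_def)
  show "x \<le> x" by (simp add: less_eq_surreal_def)
  show "x \<le> y \<Longrightarrow> y \<le> z \<Longrightarrow> x \<le> z"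
    using surreal_less_trans by (auto simp: less_eq_surreal_def)
  show "x \<le> y \<Longrightarrow> y \<le> x \<Longrightarrow> x = y"
    using surreal_less_irrefl surreal_less_trans by (auto simp: less_eq_surreal_def)
  show "x \<le> y \<or> y \<le> x"
    using surreal_less_linear by (auto simp: less_eq_surreal_def)
qed

text \<open>Undefined lies between the two signs, so the first deleted sign decides on which side of
  the truncation \<open>x\<close> lies.\<close>

lemma restr_less_iff: "restr x a < x \<longleftrightarrow> sign x a = 1"
  for x :: "'o::ordinals surreal"
proof -
  have "sign x a = 1 \<Longrightarrow> restr x a < x"
    by (auto simp: less_surreal_def sign_restr intro!: exI[of _ a])
  moreover have "sign x a = -1 \<Longrightarrow> x < restr x a"
    by (auto simp: less_surreal_def sign_restr intro!: exI[of _ a])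
  ultimately show ?thesis
    by - (rule sign_cases[of x a], auto simp: restr_self)
qed

lemma less_restr_iff: "x < restr x a \<longleftrightarrow> sign x a = -1"
  for x :: "'o::ordinals surreal"
proof -
  have "sign x a = -1 \<Longrightarrow> x < restr x a"
    by (auto simp: less_surreal_def sign_restr intro!: exI[of _ a])
  then show ?thesis
    using restr_less_iff[of x a] by - (rule sign_cases[of x a], auto simp: restr_self)
qed

text \<open>Two numbers are separated, weakly, by their longest common initial segment. Monotonicity
  of an operation therefore only has to be checked between a number and its options.\<close>

lemma meet:
  fixes x y :: "'o::ordinals surreal"
  assumes "x < y"
  obtains m where "m = x \<or> simpler m x" "m = y \<or> simpler m y" "x \<le> m" "m \<le> y"
proof -
  from assms obtain a where a: "\<And>i. i < a \<Longrightarrow> sign x i = sign y i" "sign x a < sign y a"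
    by (auto simp: less_surreal_def)
  then have r: "restr x a = restr y a" by (intro restr_eqI) auto
  have 1: "sign x a \<noteq> 1" "sign y a \<noteq> -1"
    using a(2) sign_range[of x a] sign_range[of y a] by auto
  show ?thesis
  proof (rule that[of "restr x a"])
    show "restr x a = x \<or> simpler (restr x a) x"
      using simpler_restr restr_self by (metis linorder_not_le)
    show "restr x a = y \<or> simpler (restr x a) y"
      unfolding r using simpler_restr restr_self by (metis linorder_not_le)
    show "x \<le> restr x a" using 1 restr_less_iff[of x a] by auto
    show "restr x a \<le> y" unfolding r using 1 less_restr_iff[of y a] by auto
  qed
qed

text \<open>If \<open>d\<close> left \<open>m\<close> at some place below the length of
  \<open>m\<close>, then \<open>x\<close> would still agree with \<open>m\<close> there, so
  \<open>d\<close> would lie on the same side of both and not between them. This later locates the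
  initial segments of integers, dyadics and reals.\<close>

lemma simpler_between:
  fixes m x d :: "'o::ordinals surreal"
  assumes "simpler m x" and "m \<le> d \<and> d \<le> x \<or> x \<le> d \<and> d \<le> m"
  shows "m = d \<or> simpler m d"
proof -
  obtain a where a: "a < birthday x" "m = restr x a" using assms(1) by (auto simp: simpler_iff_restr)
  have "restr d a = m"
  proof (rule ccontr)
    assume "restr d a \<noteq> m"
    then obtain b where b: "\<And>i. i < b \<Longrightarrow> sign (restr d a) i = sign m i" "sign (restr d a) b \<noteq> sign m b"
      using first_difference by blast
    then have "b < a" using a by (auto simp: sign_restr split: if_splits)
    then have *: "\<forall>i<b. sign d i = sign m i" "\<forall>i<b. sign x i = sign m i"
      "sign d b \<noteq> sign m b" "sign x b = sign m b"
      using b a less_trans[of _ b a] by (auto simp: sign_restr)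
    then have "(d < m \<longleftrightarrow> sign d b < sign m b)" "(d < x \<longleftrightarrow> sign d b < sign m b)"
      using less_iff_first_difference by metis+
    moreover have "x \<noteq> d" "m \<noteq> d" using *(3,4) by auto
    ultimately show False using assms(2) by auto
  qed
  then show ?thesis by (metis linorder_not_le restr_self simpler_restr)
qed


subsection \<open>Small sets\<close>

text \<open>Boundedness of every ordinal-valued map, the conclusion of \<open>replacement\<close>,
  distinguishes sets from proper classes. The \<open>itself\<close> argument names the ordinal type,
  which need not occur in the type of \<open>A\<close>.\<close>

definition small :: "'o::ordinals itself \<Rightarrow> 'a set \<Rightarrow> bool" where
  "small _ A \<longleftrightarrow> (\<forall>f :: 'a \<Rightarrow> 'o. \<exists>b. \<forall>x\<in>A. f x < b)"

lemma ex_greater: "\<exists>b. a < (b :: 'o::ordinals)"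
proof -
  obtain i l :: 'o where "i < l" using infinity by blast
  then show ?thesis using replacement[of l "\<lambda>_. a"] by blast
qed

lemma small_empty [simp, intro]: "small TYPE('o::ordinals) {}"
  by (simp add: small_def)

lemma small_lessThan: "small TYPE('o::ordinals) {..<a::'o}"
  unfolding small_def lessThan_iff Ball_def using replacement by blast

lemma small_subset: "small TYPE('o::ordinals) B \<Longrightarrow> A \<subseteq> B \<Longrightarrow> small TYPE('o) A"
  by (fastforce simp: small_def)

lemma small_image [intro]: "small TYPE('o::ordinals) A \<Longrightarrow> small TYPE('o) (f ` A)"
proof (unfold small_def, intro allI)
  fix g :: "'b \<Rightarrow> 'o"
  assume "\<forall>f :: 'a \<Rightarrow> 'o. \<exists>b. \<forall>x\<in>A. f x < b"
  from this[rule_format, of "g \<circ> f"] show "\<exists>b. \<forall>x\<in>f ` A. g x < b" by auto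
qed

lemma small_Un [intro]:
  assumes "small TYPE('o::ordinals) A" "small TYPE('o) B" shows "small TYPE('o) (A \<union> B)"
proof (unfold small_def, intro allI)
  fix g :: "'a \<Rightarrow> 'o"
  obtain a b where "\<forall>x\<in>A. g x < a" "\<forall>x\<in>B. g x < b"
    using assms unfolding small_def by meson
  then have "\<forall>x\<in>A \<union> B. g x < max a b" by (auto simp: less_max_iff_disj)
  then show "\<exists>b. \<forall>x\<in>A \<union> B. g x < b" by blast
qed

lemma small_Times [intro]:
  assumes "small TYPE('o::ordinals) A" "small TYPE('o) B" shows "small TYPE('o) (A \<times> B)"
proof (unfold small_def, intro allI)
  fix g :: "'a \<times> 'b \<Rightarrow> 'o"
  have "\<forall>x. \<exists>b. \<forall>y\<in>B. g (x, y) < b"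
  proof
    fix x
    show "\<exists>b. \<forall>y\<in>B. g (x, y) < b"
      using assms(2)[unfolded small_def, rule_format, of "\<lambda>y. g (x, y)"] .
  qed
  then obtain h where h: "\<forall>x. \<forall>y\<in>B. g (x, y) < h x" by metis
  obtain b where "\<forall>x\<in>A. h x < b" using assms(1) unfolding small_def by blast
  with h have "\<forall>p\<in>A \<times> B. g p < b" by (auto intro: less_trans)
  then show "\<exists>b. \<forall>x\<in>A \<times> B. g x < b" by blast
qed

text \<open>The limit ordinal from \<open>infinity\<close> contains a strictly increasing sequence
  \<open>g\<close>, and \<open>replacement\<close> below that ordinal bounds every map on it, in
  particular \<open>f\<close> composed with the inverse of \<open>g\<close>.\<close>

lemma small_nat: "small TYPE('o::ordinals) (A :: nat set)"
proof (unfold small_def, intro allI)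
  fix f :: "nat \<Rightarrow> 'o"
  obtain l :: 'o and i where l: "i < l" "\<forall>i<l. \<exists>j<l. i < j" using infinity by blast
  then have "\<forall>i. \<exists>j. i < l \<longrightarrow> j < l \<and> i < j" by blast
  then obtain s where s: "\<And>i. i < l \<Longrightarrow> s i < l \<and> i < s i" by metis
  define g where "g n = (s ^^ n) i" for n
  have gl: "g n < l" for n by (induction n) (use l s in \<open>auto simp: g_def\<close>)
  have "g n < g (Suc n)" for n using s gl[of n] by (simp add: g_def)
  then have "strict_mono g" by (simp add: strict_mono_Suc_iff)
  then have "inj g" by (rule strict_mono_imp_inj_on)
  obtain b where b: "\<forall>j<l. f (inv g j) < b" using replacement[of l "\<lambda>j. f (inv g j)"] by blast
  have "f n < b" for n
    using b[rule_format, OF gl[of n]] \<open>inj g\<close> by (simp add: inv_f_f)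
  then show "\<exists>b. \<forall>x\<in>A. f x < b" by blast
qed

lemma small_countable: "small TYPE('o::ordinals) (range (f :: 'a::countable \<Rightarrow> 'b))"
proof -
  have "range f = (\<lambda>n. f (from_nat n)) ` UNIV"
    by (auto simp: image_iff) (metis from_nat_to_nat)
  then show ?thesis using small_image[OF small_nat] by metis
qed

lemma small_simpler: "small TYPE('o::ordinals) {u. simpler u (x :: 'o surreal)}"
proof -
  have "{u. simpler u x} = restr x ` {..<birthday x}" by (auto simp: simpler_iff_restr)
  then show ?thesis using small_image[OF small_lessThan] by metis
qed

lemma small_lopt [simp, intro]: "small TYPE('o::ordinals) (lopt (x :: 'o surreal))"
  and small_ropt [simp, intro]: "small TYPE('o::ordinals) (ropt (x :: 'o surreal))"
  by (rule small_subset[OF small_simpler[of x]]; auto simp: lopt_def ropt_def)+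


subsection \<open>Cuts\<close>

text \<open>The number is found by walking down the tree of sign expansions: from a node in
  \<open>D\<close> step to the right, from a node in \<open>U\<close> step to the left, and stop at
  the first node that is in neither.\<close>

lemma between_exists:
  fixes L R :: "'o::ordinals surreal set"
  assumes "small TYPE('o) L" "small TYPE('o) R" and LR: "\<And>l r. l \<in> L \<Longrightarrow> r \<in> R \<Longrightarrow> l < r"
  shows "\<exists>x. (\<forall>l\<in>L. l < x) \<and> (\<forall>r\<in>R. x < r)"
proof -
  define D where "D = {y. \<exists>l\<in>L. y \<le> l}"
  define U where "U = {y. \<exists>r\<in>R. r \<le> y}"
  have DU: "\<not> (y \<in> D \<and> y \<in> U)" for y
    using LR unfolding D_def U_def by force
  \<comment> \<open>\<open>good p\<close> says that \<open>p\<close> is a stage of this walk: each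
    sign of \<open>p\<close> is the step dictated by the initial segment before it.\<close>
  define good where "good p \<longleftrightarrow> (\<forall>j<birthday p.
      (sign p j = 1 \<and> restr p j \<in> D) \<or> (sign p j = -1 \<and> restr p j \<in> U))" for p
  obtain b where b: "\<forall>y\<in>L \<union> R. birthday y < b"
    using small_Un[OF assms(1,2)] unfolding small_def by blast
  \<comment> \<open>The walk must stop at a set-sized stage, because every node it leaves is an
    initial segment of some member of \<open>L \<union> R\<close>. Indeed, if \<open>q\<close> is in
    \<open>D\<close> because of \<open>l\<close> but is no initial segment of \<open>l\<close>, then
    \<open>q\<close> steps to the left where the two part. The node there is in \<open>U\<close>,
    yet as an initial segment of \<open>l\<close> not above \<open>l\<close> it is also in
    \<open>D\<close>.\<close>
  have bound: "j < b" if "good p" "j < birthday p" for p j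
  proof -
    define q where "q = restr p j"
    have bq: "birthday q = j" using that by (simp add: q_def birthday_restr)
    have qg: "(sign q a = 1 \<and> restr q a \<in> D) \<or> (sign q a = -1 \<and> restr q a \<in> U)" if "a < j" for a
      using that \<open>good p\<close> \<open>j < birthday p\<close>
      by (auto simp: q_def good_def sign_restr restr_restr)
    have "\<exists>y\<in>L \<union> R. restr y j = q"
    proof (rule ccontr)
      assume no: "\<not> ?thesis"
      from that consider "q \<in> D" | "q \<in> U" unfolding good_def q_def by blast
      then show False
      proof cases
        case 1
        then obtain l where l: "l \<in> L" "q \<le> l" by (auto simp: D_def)
        with no have "restr l j \<noteq> q" "q \<noteq> l" using bq restr_self[of q j] by force+
        with l(2) have "q < l" by simp
        then obtain a where a: "\<forall>i<a. sign q i = sign l i" "sign q a < sign l a"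
          by (auto simp: less_surreal_def)
        have "a < j"
        proof (rule ccontr)
          assume "\<not> a < j"
          then have "restr q j = restr l j" using a by (intro restr_eqI) auto
          then show False using \<open>restr l j \<noteq> q\<close> bq restr_self[of q j] by simp
        qed
        have "sign q a \<noteq> 1" using a(2) sign_range[of l a] by auto
        with qg[OF \<open>a < j\<close>] have *: "sign q a = -1" "restr q a \<in> U" by auto
        have "restr q a = restr l a" using a by (intro restr_eqI) auto
        moreover have "restr l a \<le> l" using less_restr_iff[of l a] a * by auto
        ultimately have "restr q a \<in> D" using l by (auto simp: D_def)
        then show False using DU * by blast
      next
        case 2
        then obtain l where l: "l \<in> R" "l \<le> q" by (auto simp: U_def)
        with no have "restr l j \<noteq> q" "q \<noteq> l" using bq restr_self[of q j] by force+
        with l(2) have "l < q" by simp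
        then obtain a where a: "\<forall>i<a. sign l i = sign q i" "sign l a < sign q a"
          by (auto simp: less_surreal_def)
        have "a < j"
        proof (rule ccontr)
          assume "\<not> a < j"
          then have "restr q j = restr l j" using a by (intro restr_eqI) auto
          then show False using \<open>restr l j \<noteq> q\<close> bq restr_self[of q j] by simp
        qed
        have "sign q a \<noteq> -1" using a(2) sign_range[of l a] by auto
        with qg[OF \<open>a < j\<close>] have *: "sign q a = 1" "restr q a \<in> D" by auto
        have "restr q a = restr l a" using a by (intro restr_eqI) auto
        moreover have "l \<le> restr l a" using restr_less_iff[of l a] a * by auto
        ultimately have "restr q a \<in> U" using l by (auto simp: U_def)
        then show False using DU * by blast
      qed
    qed
    then obtain y where "y \<in> L \<union> R" "restr y j = q" by blast
    then have "j \<le> birthday y" using bq birthday_restr[of y j] by (metis min.cobounded2)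
    then show "j < b" using b \<open>y \<in> L \<union> R\<close> le_less_trans by blast
  qed
  \<comment> \<open>The next step is determined by the node, since \<open>D\<close> and
    \<open>U\<close> are disjoint; so the stages form a chain and \<open>s\<close> below is their
    union.\<close>
  have chain: "sign p i = sign q i" if "good p" "good q" "i < birthday p" "i < birthday q" for p q i
    using that(3,4)
  proof (induction i rule: less_induct)
    case (less i)
    then have "restr p i = restr q i" by (intro restr_eqI) auto
    moreover have "(sign p i = 1 \<and> restr p i \<in> D) \<or> (sign p i = -1 \<and> restr p i \<in> U)"
      using that(1) less.prems by (simp add: good_def)
    moreover have "(sign q i = 1 \<and> restr q i \<in> D) \<or> (sign q i = -1 \<and> restr q i \<in> U)"
      using that(2) less.prems by (simp add: good_def)
    ultimately show ?case using DU[of "restr p i"] by auto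
  qed
  define s where "s i = (if \<exists>p. good p \<and> i < birthday p
     then sign (SOME p. good p \<and> i < birthday p) i else 0)" for i
  have s: "s i = sign p i" if "good p" "i < birthday p" for p i
  proof -
    have "\<exists>p. good p \<and> i < birthday p" using that by blast
    moreover from someI_ex[OF this] have "sign (SOME p. good p \<and> i < birthday p) i = sign p i"
      by (intro chain that) blast+
    ultimately show ?thesis by (simp only: s_def if_True)
  qed
  have s0: "s i \<noteq> 0 \<Longrightarrow> \<exists>p. good p \<and> i < birthday p" for i
    unfolding s_def by presburger
  define X where "X = Surreal s"
  have X: "sign X = s" unfolding X_def
  proof (rule sign_Surreal)
    show "s i \<in> {-1, 0, 1}" for i
      using sign_range[of "SOME p. good p \<and> i < birthday p" i] unfolding s_def
      by (simp split: if_split)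
    show "s i \<noteq> 0" if ij: "i < j" "s j \<noteq> 0" for i j
    proof -
      obtain p where p: "good p" "j < birthday p" using s0[OF ij(2)] by blast
      then have "i < birthday p" using ij by simp
      then show ?thesis using s[OF p(1)] sign_nonzero_iff[of p i] by simp
    qed
    show "i < b" if "s i \<noteq> 0" for i using s0[OF that] bound by blast
  qed
  have goodX: "good X" unfolding good_def
  proof (intro allI impI)
    fix j assume "j < birthday X"
    then obtain p where p: "good p" "j < birthday p"
      using s0[of j] sign_nonzero_iff[of X j] X by auto
    have "restr X j = restr p j"
      by (intro restr_eqI) (use s[OF p(1)] p(2) X in auto)
    then show "(sign X j = 1 \<and> restr X j \<in> D) \<or> (sign X j = -1 \<and> restr X j \<in> U)"
      using p s[OF p] X unfolding good_def by auto
  qed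
  \<comment> \<open>If the union \<open>X\<close> were still in \<open>D\<close> or
    \<open>U\<close>, appending the dictated sign \<open>e\<close> would give a longer stage
    \<open>Y\<close>, so \<open>X\<close> would have a sign at its own birthday.\<close>
  have ext: False if e: "e = 1 \<and> X \<in> D \<or> e = -1 \<and> X \<in> U" for e :: int
  proof -
    define a where "a = birthday X"
    obtain c where c: "a < c" using ex_greater by blast
    define t where "t = (\<lambda>i. if i < a then sign X i else if i = a then e else 0)"
    define Y where "Y = Surreal t"
    have Y: "sign Y = t" unfolding Y_def
      by (rule sign_Surreal[where b = c])
         (use sign_range[of X] e c in \<open>auto simp: t_def a_def sign_eq_0_iff split: if_splits\<close>)
    have bY: "i < birthday Y \<longleftrightarrow> i \<le> a" for i
    proof -
      have "t i \<noteq> 0 \<longleftrightarrow> i \<le> a"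
        using sign_nonzero_iff[of X i] e by (cases i a rule: linorder_cases) (auto simp: t_def a_def)
      then show ?thesis using sign_nonzero_iff[of Y i] Y by metis
    qed
    have r: "restr Y i = restr X i" if "i \<le> a" for i
      using that by (intro restr_eqI) (auto simp: Y t_def)
    have "good Y" unfolding good_def bY
    proof (intro allI impI)
      fix j assume "j \<le> a"
      then consider "j < a" | "j = a" by force
      then show "sign Y j = 1 \<and> restr Y j \<in> D \<or> sign Y j = -1 \<and> restr Y j \<in> U"
      proof cases
        case 1
        then show ?thesis using goodX by (auto simp: good_def r a_def Y t_def)
      next
        case 2
        then show ?thesis using e by (auto simp: r Y t_def a_def restr_self)
      qed
    qed
    then have "s a = e" using s[of Y a] bY by (simp add: Y t_def)
    then have "sign X a \<noteq> 0" using e X by auto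
    then show False by (simp add: a_def sign_nonzero_iff)
  qed
  show ?thesis
  proof (intro exI conjI ballI)
    show "l < X" if "l \<in> L" for l
      using ext[of 1] that unfolding D_def by force
    show "X < r" if "r \<in> R" for r
      using ext[of "-1"] that unfolding U_def by force
  qed
qed

text \<open>Minimality is tested only against the initial segments of \<open>x\<close>, a local
  condition that can be verified by hand; \<open>is_cut_simpler\<close> recovers from it the
  comparison with all competitors that occurs in \<open>cut\<close>.\<close>

definition is_cut :: "'o::ordinals surreal \<Rightarrow> 'o surreal set \<Rightarrow> 'o surreal set \<Rightarrow> bool" where
  "is_cut x L R \<longleftrightarrow> (\<forall>l\<in>L. l < x) \<and> (\<forall>r\<in>R. x < r) \<and>
     (\<forall>u. simpler u x \<longrightarrow> (\<exists>l\<in>L. u \<le> l) \<or> (\<exists>r\<in>R. r \<le> u))"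

lemma is_cut_less: "is_cut x L R \<Longrightarrow> l \<in> L \<Longrightarrow> l < x"
  and is_cut_greater: "is_cut x L R \<Longrightarrow> r \<in> R \<Longrightarrow> x < r"
  by (auto simp: is_cut_def)

lemma is_cut_cofinal: "is_cut x L R \<Longrightarrow> u \<in> lopt x \<Longrightarrow> \<exists>l\<in>L. u \<le> l"
  and is_cut_coinitial: "is_cut x L R \<Longrightarrow> v \<in> ropt x \<Longrightarrow> \<exists>r\<in>R. r \<le> v"
  unfolding is_cut_def lopt_def ropt_def by force+

lemma is_cutI:
  assumes "\<And>l. l \<in> L \<Longrightarrow> l < x" "\<And>r. r \<in> R \<Longrightarrow> x < r"
    and "\<And>u. u \<in> lopt x \<Longrightarrow> \<exists>l\<in>L. u \<le> l" "\<And>v. v \<in> ropt x \<Longrightarrow> \<exists>r\<in>R. r \<le> v"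
  shows "is_cut x L R"
  unfolding is_cut_def
proof (intro conjI allI impI ballI)
  fix u assume u: "simpler u x"
  then have "u \<noteq> x" using not_simpler_self by blast
  with u have "u \<in> lopt x \<or> u \<in> ropt x" by (auto simp: lopt_def ropt_def)
  then show "(\<exists>l\<in>L. u \<le> l) \<or> (\<exists>r\<in>R. r \<le> u)" using assms(3,4) by blast
qed (use assms in auto)

lemma is_cut_canonical: "is_cut x (lopt x) (ropt x)"
  by (rule is_cutI) (auto simp: lopt_def ropt_def)

text \<open>The longest common initial segment of \<open>x\<close> and \<open>y\<close> lies weakly
  between them and hence in the cut. Being an initial segment of \<open>x\<close>, it can only be
  \<open>x\<close> itself.\<close>

lemma is_cut_simpler:
  assumes x: "is_cut x L R" and "\<And>l. l \<in> L \<Longrightarrow> l < y" "\<And>r. r \<in> R \<Longrightarrow> y < r"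
  shows "y = x \<or> simpler x y"
proof (rule ccontr)
  assume no: "\<not> ?thesis"
  then have "x < y \<or> y < x" by auto
  then obtain m where m: "m = x \<or> simpler m x" "m = y \<or> simpler m y" "min x y \<le> m" "m \<le> max x y"
  proof
    assume "x < y" then show thesis by (rule meet) (use that \<open>x < y\<close> in auto)
  next
    assume "y < x" then show thesis by (rule meet) (use that \<open>y < x\<close> in auto)
  qed
  then have "simpler m x" using no by blast
  moreover have "l < m" if "l \<in> L" for l
    using assms(2)[OF that] is_cut_less[OF x that] m(3) by (auto simp: min_def split: if_splits)
  moreover have "m < r" if "r \<in> R" for r
    using assms(3)[OF that] is_cut_greater[OF x that] m(4) by (auto simp: max_def split: if_splits)
  ultimately show False using x unfolding is_cut_def by force
qed

lemma cut_eqI: "is_cut x L R \<Longrightarrow> cut L R = x"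
  unfolding cut_def
proof (rule the_equality)
  assume x: "is_cut x L R"
  show "(\<forall>l\<in>L. l < x) \<and> (\<forall>r\<in>R. x < r) \<and>
     (\<forall>y. (\<forall>l\<in>L. l < y) \<and> (\<forall>r\<in>R. y < r) \<longrightarrow> y = x \<or> simpler x y)"
    using x is_cut_simpler[OF x] by (auto simp: is_cut_def)
  then show "y = x" if "(\<forall>l\<in>L. l < y) \<and> (\<forall>r\<in>R. y < r) \<and>
     (\<forall>z. (\<forall>l\<in>L. l < z) \<and> (\<forall>r\<in>R. z < r) \<longrightarrow> z = y \<or> simpler y z)" for y
    using that simpler_asym by blast
qed

text \<open>Among the numbers in the cut take one of least birthday: its proper initial segments are
  born earlier, so they fall outside.\<close>

lemma is_cut_cut:
  fixes L R :: "'o::ordinals surreal set"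
  assumes "small TYPE('o) L" "small TYPE('o) R" and "\<And>l r. l \<in> L \<Longrightarrow> r \<in> R \<Longrightarrow> l < r"
  shows "is_cut (cut L R) L R"
proof -
  let ?P = "\<lambda>x. (\<forall>l\<in>L. l < x) \<and> (\<forall>r\<in>R. x < r)"
  have "\<exists>x. ?P x" using between_exists[OF assms] .
  then obtain z where "?P z" by blast
  define a where "a = (LEAST a. \<exists>x. ?P x \<and> birthday x = a)"
  have "\<exists>x. ?P x \<and> birthday x = a"
    unfolding a_def by (rule LeastI[of _ "birthday z"]) (use \<open>?P z\<close> in blast)
  then obtain x where x: "?P x" "birthday x = a" by blast
  have min: "a \<le> birthday y" if "?P y" for y
    unfolding a_def by (rule Least_le) (use that in blast)
  have "is_cut x L R" unfolding is_cut_def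
  proof (intro conjI allI impI)
    fix u assume u: "simpler u x"
    have "\<not> ?P u"
    proof
      assume "?P u"
      from min[OF this] show False using x(2) simpler_birthday[OF u] by simp
    qed
    then show "(\<exists>l\<in>L. u \<le> l) \<or> (\<exists>r\<in>R. r \<le> u)" by (auto simp: not_less)
  qed (use x in auto)
  then show ?thesis using cut_eqI by metis
qed

text \<open>Each number lies in the cut of the other, so each is equal to or simpler than the other.
  For proving identities this is convenient because the two families of options need not match; they
  only have to lie on the right sides.\<close>

lemma is_cut_unique:
  assumes "is_cut x L R" "is_cut y L' R'"
    and "\<And>l. l \<in> L \<Longrightarrow> l < y" "\<And>r. r \<in> R \<Longrightarrow> y < r"
    and "\<And>l. l \<in> L' \<Longrightarrow> l < x" "\<And>r. r \<in> R' \<Longrightarrow> x < r"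
  shows "x = y"
  using is_cut_simpler[OF assms(1), of y] is_cut_simpler[OF assms(2), of x] assms simpler_asym by blast


section \<open>Induction over initial segments, and monotonicity\<close>

lemma surreal_induct:
  assumes "\<And>x. (\<And>u. simpler u x \<Longrightarrow> P u) \<Longrightarrow> P x"
  shows "P x"
proof (induction "birthday x" arbitrary: x rule: less_induct)
  case less
  then show ?case using assms simpler_birthday by blast
qed

text \<open>Lexicographic: once the first argument has become simpler, the second one is free.
  Inequalities that pass through pairs \<open>u\<close>, \<open>v\<close> of options use this
  freedom.\<close>

lemma surreal_induct2:
  assumes "\<And>x y. (\<And>u v. simpler u x \<Longrightarrow> P u v) \<Longrightarrow> (\<And>v. simpler v y \<Longrightarrow> P x v) \<Longrightarrow> P x y"
  shows "P x y"
proof (induction x arbitrary: y rule: surreal_induct)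
  case (1 x y)
  note IH = 1
  show ?case by (induction y rule: surreal_induct) (use assms IH in blast)
qed

lemma surreal_induct3:
  assumes "\<And>x y z. (\<And>u v w. simpler u x \<Longrightarrow> P u v w) \<Longrightarrow> (\<And>v w. simpler v y \<Longrightarrow> P x v w) \<Longrightarrow>
     (\<And>w. simpler w z \<Longrightarrow> P x y w) \<Longrightarrow> P x y z"
  shows "P x y z"
proof (induction x arbitrary: y z rule: surreal_induct)
  case (1 x y z)
  note IH = 1
  show ?case by (induction y z rule: surreal_induct2) (use assms IH in blast)
qed

lemma lopt_simpler: "u \<in> lopt x \<Longrightarrow> simpler u x"
  and ropt_simpler: "v \<in> ropt x \<Longrightarrow> simpler v x"
  and lopt_less: "u \<in> lopt x \<Longrightarrow> u < x"
  and ropt_greater: "v \<in> ropt x \<Longrightarrow> x < v"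
  by (auto simp: lopt_def ropt_def)

text \<open>Initial segments of one number are nested, so of two options one is an option of the
  other. This lets an induction hypothesis compare them before monotonicity is available.\<close>

lemma lopt_ropt_comparable:
  assumes "u \<in> lopt x" "v \<in> ropt x"
  shows "u < v" and "u \<in> lopt v \<or> v \<in> ropt u"
proof -
  show "u < v" using assms lopt_less ropt_greater less_trans by blast
  with assms show "u \<in> lopt v \<or> v \<in> ropt u"
    using simpler_linear[of u x v] by (auto simp: lopt_def ropt_def)
qed

lemma strict_mono_optionsI:
  assumes "\<And>x u. u \<in> lopt x \<Longrightarrow> f u < (f x :: 'b::order)" "\<And>x v. v \<in> ropt x \<Longrightarrow> f x < f v"
    and "x < y"
  shows "f x < f y"
proof -
  from \<open>x < y\<close> obtain m where m: "m = x \<or> simpler m x" "m = y \<or> simpler m y" "x \<le> m" "m \<le> y"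
    by (rule meet)
  show ?thesis
  proof (cases "m = x")
    case True
    then have "m \<in> lopt y" using m \<open>x < y\<close> by (auto simp: lopt_def)
    then show ?thesis using assms(1)[of m y] True by simp
  next
    case False
    then have "m \<in> ropt x" using m by (auto simp: ropt_def)
    then have *: "f x < f m" by (rule assms(2))
    show ?thesis
    proof (cases "m = y")
      case False
      then have "m \<in> lopt y" using m by (auto simp: lopt_def)
      then show ?thesis using * assms(1)[of m y] by (blast intro: less_trans)
    qed (use * in simp)
  qed
qed


section \<open>The ordered additive group\<close>

lemma surreal_add_commute: "x + y = y + (x :: 'o::ordinals surreal)"
proof (induction x y rule: surreal_induct2)
  case (1 x y)
  have "(\<lambda>u. u + y) ` lopt x = (\<lambda>u. y + u) ` lopt x" "(\<lambda>u. u + y) ` ropt x = (\<lambda>u. y + u) ` ropt x"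
    by (rule image_cong[OF refl], rule 1(1), erule lopt_simpler ropt_simpler)+
  moreover have "(\<lambda>v. x + v) ` lopt y = (\<lambda>v. v + x) ` lopt y" "(\<lambda>v. x + v) ` ropt y = (\<lambda>v. v + x) ` ropt y"
    by (rule image_cong[OF refl], rule 1(2), erule lopt_simpler ropt_simpler)+
  ultimately show ?case
    unfolding plus_surreal.simps[of x y] plus_surreal.simps[of y x] by (simp only: Un_commute)
qed

text \<open>Existence of the cut and monotonicity are one induction: that simpler sums lie in their
  cuts gives the inequalities between left and right options. If both options vary the same summand,
  one is an option of the other; the mixed cases pass through \<open>u + v\<close>.\<close>

lemma plus_is_cut_canonical:
  "is_cut (x + y :: 'o::ordinals surreal)
     ((\<lambda>u. u + y) ` lopt x \<union> (\<lambda>v. x + v) ` lopt y)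
     ((\<lambda>u. u + y) ` ropt x \<union> (\<lambda>v. x + v) ` ropt y)"
proof (induction x y rule: surreal_induct2)
  case (1 x y)
  have l1: "u' + v < u + v" if "simpler u x" "u' \<in> lopt u" for u u' v
    using is_cut_less[OF 1(1)[OF that(1)]] that(2) by blast
  have r1: "u + v < u' + v" if "simpler u x" "u' \<in> ropt u" for u u' v
    using is_cut_greater[OF 1(1)[OF that(1)]] that(2) by blast
  have l1': "u + v' < u + v" if "simpler u x" "v' \<in> lopt v" for u v v'
    using is_cut_less[OF 1(1)[OF that(1)]] that(2) by blast
  have r1': "u + v < u + v'" if "simpler u x" "v' \<in> ropt v" for u v v'
    using is_cut_greater[OF 1(1)[OF that(1)]] that(2) by blast
  have l2: "u + v < x + v" if "simpler v y" "u \<in> lopt x" for u v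
    using is_cut_less[OF 1(2)[OF that(1)]] that(2) by blast
  have r2: "x + v < u + v" if "simpler v y" "u \<in> ropt x" for u v
    using is_cut_greater[OF 1(2)[OF that(1)]] that(2) by blast
  have l2': "x + v' < x + v" if "simpler v y" "v' \<in> lopt v" for v v'
    using is_cut_less[OF 1(2)[OF that(1)]] that(2) by blast
  have r2': "x + v < x + v'" if "simpler v y" "v' \<in> ropt v" for v v'
    using is_cut_greater[OF 1(2)[OF that(1)]] that(2) by blast
  show ?case
    unfolding plus_surreal.simps[of x y]
  proof (rule is_cut_cut)
    fix l r
    assume "l \<in> (\<lambda>u. u + y) ` lopt x \<union> (\<lambda>v. x + v) ` lopt y"
      "r \<in> (\<lambda>u. u + y) ` ropt x \<union> (\<lambda>v. x + v) ` ropt y"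
    then consider u u' where "u \<in> lopt x" "u' \<in> ropt x" "l = u + y" "r = u' + y"
      | u v where "u \<in> lopt x" "v \<in> ropt y" "l = u + y" "r = x + v"
      | v u where "v \<in> lopt y" "u \<in> ropt x" "l = x + v" "r = u + y"
      | v v' where "v \<in> lopt y" "v' \<in> ropt y" "l = x + v" "r = x + v'"
      by blast
    then show "l < r"
    proof cases
      case 1
      then show ?thesis
        using lopt_ropt_comparable(2)[OF 1(1,2)] l1[of u' u y] r1[of u u' y]
          lopt_simpler ropt_simpler by blast
    next
      case 2
      have "u + y < u + v" using 2 r1' lopt_simpler by blast
      also have "\<dots> < x + v" using 2 l2 ropt_simpler by blast
      finally show ?thesis using 2 by simp
    next
      case 3
      have "x + v < u + v" using 3 r2 lopt_simpler by blast
      also have "\<dots> < u + y" using 3 l1' ropt_simpler by blast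
      finally show ?thesis using 3 by simp
    next
      case 4
      then show ?thesis
        using lopt_ropt_comparable(2)[OF 4(1,2)] l2'[of v' v] r2'[of v v']
          lopt_simpler ropt_simpler by blast
    qed
  qed (intro small_Un small_image small_lopt small_ropt)+
qed

lemma surreal_add_strict_left_mono: "y < y' \<Longrightarrow> x + y < x + (y' :: 'o::ordinals surreal)"
  by (rule strict_mono_optionsI[where f = "\<lambda>v. x + v"])
     (blast intro: is_cut_less[OF plus_is_cut_canonical] is_cut_greater[OF plus_is_cut_canonical])+

lemma surreal_add_strict_right_mono: "x < x' \<Longrightarrow> x + y < x' + (y :: 'o::ordinals surreal)"
  using surreal_add_strict_left_mono surreal_add_commute by metis

lemma surreal_add_left_mono: "y \<le> y' \<Longrightarrow> x + y \<le> x + (y' :: 'o::ordinals surreal)"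
  using surreal_add_strict_left_mono by (auto simp: order_le_less)

lemma surreal_add_right_mono: "x \<le> x' \<Longrightarrow> x + y \<le> x' + (y :: 'o::ordinals surreal)"
  using surreal_add_strict_right_mono by (auto simp: order_le_less)

text \<open>The cofinality principle: options may be exchanged for others on the proper sides of
  \<open>z\<close> that are at least as close to it.\<close>

lemma is_cut_replace:
  assumes z: "is_cut z A B" and "\<And>l. l \<in> L \<Longrightarrow> l < z" "\<And>r. r \<in> R \<Longrightarrow> z < r"
    and "\<And>a. a \<in> A \<Longrightarrow> \<exists>l\<in>L. a \<le> l" "\<And>b. b \<in> B \<Longrightarrow> \<exists>r\<in>R. r \<le> b"
  shows "is_cut z L R"
proof (rule is_cutI)
  show "\<exists>l\<in>L. u \<le> l" if "u \<in> lopt z" for u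
    using is_cut_cofinal[OF z that] assms(4) by (meson order_trans)
  show "\<exists>r\<in>R. r \<le> u" if "u \<in> ropt z" for u
    using is_cut_coinitial[OF z that] assms(5) by (meson order_trans)
qed (use assms(2,3) in auto)

text \<open>Uniformity: the recursion for sums holds for every representation of the summands as
  cuts. It is what allows a nested sum to be unfolded, since the natural options of
  \<open>x + y\<close> are not its initial segments.\<close>

lemma is_cut_plus:
  assumes x: "is_cut x L R" and y: "is_cut (y :: 'o::ordinals surreal) L' R'"
  shows "is_cut (x + y) ((\<lambda>u. u + y) ` L \<union> (\<lambda>v. x + v) ` L')
     ((\<lambda>u. u + y) ` R \<union> (\<lambda>v. x + v) ` R')" (is "is_cut _ ?L ?R")
proof (rule is_cut_replace[OF plus_is_cut_canonical])
  fix a assume "a \<in> (\<lambda>u. u + y) ` lopt x \<union> (\<lambda>v. x + v) ` lopt y"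
  then consider u where "u \<in> lopt x" "a = u + y" | v where "v \<in> lopt y" "a = x + v" by blast
  then show "\<exists>l\<in>?L. a \<le> l"
  proof cases
    case 1
    then obtain u' where "u' \<in> L" "u \<le> u'" using is_cut_cofinal[OF x] by blast
    then show ?thesis using surreal_add_right_mono[of u u' y] 1 by blast
  next
    case 2
    then obtain v' where "v' \<in> L'" "v \<le> v'" using is_cut_cofinal[OF y] by blast
    then show ?thesis using surreal_add_left_mono[of v v' x] 2 by blast
  qed
next
  fix a assume "a \<in> (\<lambda>u. u + y) ` ropt x \<union> (\<lambda>v. x + v) ` ropt y"
  then consider u where "u \<in> ropt x" "a = u + y" | v where "v \<in> ropt y" "a = x + v" by blast
  then show "\<exists>r\<in>?R. r \<le> a"
  proof cases
    case 1
    then obtain u' where "u' \<in> R" "u' \<le> u" using is_cut_coinitial[OF x] by blast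
    then show ?thesis using surreal_add_right_mono[of u' u y] 1 by blast
  next
    case 2
    then obtain v' where "v' \<in> R'" "v' \<le> v" using is_cut_coinitial[OF y] by blast
    then show ?thesis using surreal_add_left_mono[of v' v x] 2 by blast
  qed
next
  show "l < x + y" if "l \<in> ?L" for l
    using that by (auto intro: surreal_add_strict_left_mono surreal_add_strict_right_mono
      is_cut_less[OF x] is_cut_less[OF y])
  show "x + y < r" if "r \<in> ?R" for r
    using that by (auto intro: surreal_add_strict_left_mono surreal_add_strict_right_mono
      is_cut_greater[OF x] is_cut_greater[OF y])
qed

lemma is_cut_same_eq: "is_cut x L R \<Longrightarrow> is_cut y L R \<Longrightarrow> x = y"
  using cut_eqI by metis

text \<open>Unfolded by uniformity, both sides have options in which one of the three summands is
  replaced; the induction hypothesis makes the two families literally equal.\<close>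

lemma surreal_add_assoc: "(x + y) + z = x + (y + (z :: 'o::ordinals surreal))"
proof (induction x y z rule: surreal_induct3)
  case (1 x y z)
  note IH = 1(1)[OF lopt_simpler] 1(1)[OF ropt_simpler] 1(2)[OF lopt_simpler]
    1(2)[OF ropt_simpler] 1(3)[OF lopt_simpler] 1(3)[OF ropt_simpler]
  note l = is_cut_plus[OF plus_is_cut_canonical[of x y] is_cut_canonical[of z]]
  note r = is_cut_plus[OF is_cut_canonical[of x] plus_is_cut_canonical[of y z]]
  show ?case
    by (rule is_cut_same_eq[OF l]) (use r in \<open>simp add: image_Un image_image IH Un_assoc cong: image_cong\<close>)
qed

lemma is_cut_0: "is_cut 0 {} ({} :: 'o::ordinals surreal set)"
  unfolding zero_surreal_def by (rule is_cut_cut) auto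

lemma lopt_0 [simp]: "lopt 0 = {}" and ropt_0 [simp]: "ropt 0 = {}"
  using is_cut_cofinal[OF is_cut_0] is_cut_coinitial[OF is_cut_0] by auto

lemma zero_simpler: "x \<noteq> 0 \<Longrightarrow> simpler 0 x"
  using is_cut_simpler[OF is_cut_0] by blast

lemma surreal_add_0_right: "x + 0 = (x :: 'o::ordinals surreal)"
proof (induction x rule: surreal_induct)
  case (1 x)
  have "is_cut (x + 0) (lopt x) (ropt x)"
    using is_cut_plus[OF is_cut_canonical[of x] is_cut_0] 1[OF lopt_simpler] 1[OF ropt_simpler]
    by (simp cong: image_cong)
  then show ?case using is_cut_canonical is_cut_same_eq by blast
qed

lemma sign_uminus: "sign (- x) i = - sign x i"
proof -
  have "sign (- x) = (\<lambda>i. - sign x i)"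
    unfolding uminus_surreal_def
  proof (rule sign_Surreal[where b = "birthday x"])
    show "- sign x i \<in> {-1, 0, 1}" for i using sign_range[of x i] by auto
  qed (auto simp: sign_eq_0_iff)
  then show ?thesis by simp
qed

lemma surreal_uminus_uminus: "- (- x) = (x :: 'o::ordinals surreal)"
  by (rule surreal_eqI) (simp add: sign_uminus)

lemma birthday_uminus: "birthday (- x) = birthday x"
  by (simp add: birthday_def sign_uminus)

lemma simpler_uminus: "simpler (- u) (- x) \<longleftrightarrow> simpler u x"
  by (simp add: simpler_def sign_uminus birthday_uminus)

lemma surreal_uminus_less: "- x < - y \<longleftrightarrow> y < (x :: 'o::ordinals surreal)"
  unfolding less_surreal_def by (simp add: sign_uminus eq_commute[of "sign x _"])

lemma lopt_uminus: "lopt (- x) = uminus ` ropt x" and ropt_uminus: "ropt (- x) = uminus ` lopt x"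
proof -
  have *: "u \<in> lopt (- x) \<longleftrightarrow> - u \<in> ropt x" for u and x :: "'a surreal"
    using simpler_uminus[of "- u" x] surreal_uminus_less[of "- u" x]
    by (simp add: lopt_def ropt_def surreal_uminus_uminus)
  have **: "u \<in> ropt (- x) \<longleftrightarrow> - u \<in> lopt x" for u and x :: "'a surreal"
    using simpler_uminus[of "- u" x] surreal_uminus_less[of x "- u"]
    by (simp add: lopt_def ropt_def surreal_uminus_uminus)
  show "lopt (- x) = uminus ` ropt x" "ropt (- x) = uminus ` lopt x"
    using surreal_uminus_uminus[of x] by (auto simp: * ** image_iff) (metis surreal_uminus_uminus)+
qed

text \<open>As 0 has no options, each option of \<open>x + (- x)\<close> only has to lie on its side
  of 0, and this is seen by comparison with \<open>u + (- u) = 0\<close>.\<close>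

lemma surreal_add_uminus: "x + (- x) = (0 :: 'o::ordinals surreal)"
proof (induction x rule: surreal_induct)
  case (1 x)
  have l: "u + (- x) < 0" "0 < x + (- u)" if "u \<in> lopt x" for u
  proof -
    have "u + (- u) = 0" using that 1 lopt_simpler by blast
    moreover have "u + (- x) < u + (- u)" "u + (- u) < x + (- u)"
      by (rule surreal_add_strict_left_mono surreal_add_strict_right_mono,
          use that in \<open>simp add: surreal_uminus_less lopt_less\<close>)+
    ultimately show "u + (- x) < 0" "0 < x + (- u)" by auto
  qed
  have r: "x + (- u) < 0" "0 < u + (- x)" if "u \<in> ropt x" for u
  proof -
    have "u + (- u) = 0" using that 1 ropt_simpler by blast
    moreover have "u + (- u) < u + (- x)" "x + (- u) < u + (- u)"
      by (rule surreal_add_strict_left_mono surreal_add_strict_right_mono,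
          use that in \<open>simp add: surreal_uminus_less ropt_greater\<close>)+
    ultimately show "x + (- u) < 0" "0 < u + (- x)" by auto
  qed
  show ?case
    by (rule is_cut_unique[OF plus_is_cut_canonical is_cut_0])
       (use l r in \<open>auto simp: lopt_uminus ropt_uminus\<close>)
qed

instance surreal :: (ordinals) linordered_ab_group_add
proof
  fix a b c :: "'a surreal"
  show "a + b + c = a + (b + c)" by (rule surreal_add_assoc)
  show "a + b = b + a" by (rule surreal_add_commute)
  show "0 + a = a" using surreal_add_0_right surreal_add_commute by metis
  show "- a + a = 0" using surreal_add_uminus surreal_add_commute by metis
  show "a - b = a + - b" by (rule minus_surreal_def)
  show "a \<le> b \<Longrightarrow> c + a \<le> c + b" by (rule surreal_add_left_mono)
qed


section \<open>The ordered ring\<close>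

text \<open>In a ring \<open>x * y - times_opt x y u v\<close> equals
  \<open>(x - u) * (y - v)\<close>, whose sign explains which pairs of options go to the left and
  which to the right.\<close>

definition times_opt :: "'o::ordinals surreal \<Rightarrow> 'o surreal \<Rightarrow> 'o surreal \<Rightarrow> 'o surreal \<Rightarrow> 'o surreal" where
  "times_opt x y u v = u * y + x * v - u * v"

text \<open>\<open>box u x v y\<close> says that $(x - u)(y - v) > 0$, in a form that does not presuppose the ring
  laws.\<close>

definition box :: "'o::ordinals surreal \<Rightarrow> 'o surreal \<Rightarrow> 'o surreal \<Rightarrow> 'o surreal \<Rightarrow> bool" where
  "box u x v y \<longleftrightarrow> u * y + x * v < u * v + x * y"

text \<open>Additive laws alone turn every comparison with a product option into a
  \<open>box\<close>, with rearranged summands. So the induction for products can be run before any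
  law of multiplication beyond commutativity is known.\<close>

lemma times_opt_less_iff:
  "times_opt x y u v < times_opt x y u' v \<longleftrightarrow> u * y + u' * v < u * v + u' * y"
  "times_opt x y u v < times_opt x y u v' \<longleftrightarrow> x * v + u * v' < x * v' + u * v"
  "times_opt x y u v < x * y \<longleftrightarrow> u * y + x * v < u * v + x * y"
  "x * y < times_opt x y u v \<longleftrightarrow> u * v + x * y < u * y + x * v"
  by (simp_all add: times_opt_def algebra_simps)

lemma times_unfold:
  "x * y = cut ((\<lambda>(u, v). times_opt x y u v) ` (lopt x \<times> lopt y \<union> ropt x \<times> ropt y))
     ((\<lambda>(u, v). times_opt x y u v) ` (lopt x \<times> ropt y \<union> ropt x \<times> lopt y))"
  unfolding times_opt_def by (rule times_surreal.simps)

lemma image_swap_cong: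
  assumes "\<And>u v. u \<in> A \<Longrightarrow> v \<in> B \<Longrightarrow> g u v = h v u"
  shows "(\<lambda>(u, v). g u v) ` (A \<times> B) = (\<lambda>(v, u). h v u) ` (B \<times> A)"
  using assms by (auto simp: image_iff Bex_def) metis+

lemma surreal_mult_commute: "x * y = y * (x :: 'o::ordinals surreal)"
proof (induction x y rule: surreal_induct2)
  case (1 x y)
  have *: "times_opt x y u v = times_opt y x v u" if "simpler u x" "simpler v y" for u v
    using 1(1)[OF that(1)] 1(2)[OF that(2)] unfolding times_opt_def by (simp add: add.commute)
  have "(\<lambda>(u, v). times_opt x y u v) ` (A \<times> B) = (\<lambda>(v, u). times_opt y x v u) ` (B \<times> A)"
    if "A \<in> {lopt x, ropt x}" "B \<in> {lopt y, ropt y}" for A B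
    by (rule image_swap_cong, rule *) (use that lopt_simpler ropt_simpler in auto)
  then show ?case
    unfolding times_unfold[of x y] times_unfold[of y x] image_Un by (simp add: Un_commute)
qed

definition times_wd :: "'o::ordinals surreal \<Rightarrow> 'o surreal \<Rightarrow> bool" where
  "times_wd x y \<longleftrightarrow> is_cut (x * y)
     ((\<lambda>(u, v). times_opt x y u v) ` (lopt x \<times> lopt y \<union> ropt x \<times> ropt y))
     ((\<lambda>(u, v). times_opt x y u v) ` (lopt x \<times> ropt y \<union> ropt x \<times> lopt y))"

lemma times_wd_box:
  assumes "times_wd x y"
  shows "u \<in> lopt x \<Longrightarrow> v \<in> lopt y \<Longrightarrow> box u x v y"
    and "u \<in> lopt x \<Longrightarrow> v \<in> ropt y \<Longrightarrow> box u x y v"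
    and "u \<in> ropt x \<Longrightarrow> v \<in> lopt y \<Longrightarrow> box x u v y"
    and "u \<in> ropt x \<Longrightarrow> v \<in> ropt y \<Longrightarrow> box x u y v"
proof -
  have less: "times_opt x y u v < x * y"
    if "(u, v) \<in> lopt x \<times> lopt y \<union> ropt x \<times> ropt y" for u v
    using is_cut_less[OF assms[unfolded times_wd_def]] that by force
  have greater: "x * y < times_opt x y u v"
    if "(u, v) \<in> lopt x \<times> ropt y \<union> ropt x \<times> lopt y" for u v
    using is_cut_greater[OF assms[unfolded times_wd_def]] that by force
  show "u \<in> lopt x \<Longrightarrow> v \<in> lopt y \<Longrightarrow> box u x v y"
    "u \<in> ropt x \<Longrightarrow> v \<in> ropt y \<Longrightarrow> box x u y v"
    using less[of u v] by (simp_all add: times_opt_less_iff box_def add.commute)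
  show "u \<in> lopt x \<Longrightarrow> v \<in> ropt y \<Longrightarrow> box u x y v"
    "u \<in> ropt x \<Longrightarrow> v \<in> lopt y \<Longrightarrow> box x u v y"
    using greater[of u v] by (simp_all add: times_opt_less_iff box_def add.commute)
qed

lemma comparable_initial_segments:
  assumes "simpler u x" "simpler v x" "u < v"
  shows "u \<in> lopt v \<or> v \<in> ropt u"
  using simpler_linear[OF assms(1,2)] assms(3) by (auto simp: lopt_def ropt_def)

text \<open>As for sums, that simpler products lie in their cuts gives the required inequalities,
  here in the form of boxes between nested options.\<close>

lemma times_wd: "times_wd x y"
proof (induction x y rule: surreal_induct2)
  case (1 x y)
  \<comment> \<open>In a row two initial segments of \<open>x\<close> meet an option of
    \<open>y\<close> and \<open>y\<close> itself; in a column the roles are exchanged. The larger of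
    the two segments has the other as a left option, or the smaller has it as a right option, and
    \<open>times_wd_box\<close> applies there.\<close>
  have row: "box u u' v y" if "simpler u x" "simpler u' x" "u < u'" "v \<in> lopt y" for u u' v
    using comparable_initial_segments[OF that(1-3)]
      times_wd_box[OF 1(1)[OF that(1)]] times_wd_box[OF 1(1)[OF that(2)]] that(4) by blast
  have row': "box u u' y v" if "simpler u x" "simpler u' x" "u < u'" "v \<in> ropt y" for u u' v
    using comparable_initial_segments[OF that(1-3)]
      times_wd_box[OF 1(1)[OF that(1)]] times_wd_box[OF 1(1)[OF that(2)]] that(4) by blast
  have col: "box u x v v'" if "simpler v y" "simpler v' y" "v < v'" "u \<in> lopt x" for u v v'
    using comparable_initial_segments[OF that(1-3)]
      times_wd_box[OF 1(2)[OF that(1)]] times_wd_box[OF 1(2)[OF that(2)]] that(4) by blast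
  have col': "box x u v v'" if "simpler v y" "simpler v' y" "v < v'" "u \<in> ropt x" for u v v'
    using comparable_initial_segments[OF that(1-3)]
      times_wd_box[OF 1(2)[OF that(1)]] times_wd_box[OF 1(2)[OF that(2)]] that(4) by blast
  let ?f = "times_opt x y"
  have s1: "?f u v < ?f u' v" if "box u u' v y" for u u' v
    using that by (simp add: times_opt_less_iff box_def)
  have s2: "?f u' v < ?f u v" if "box u u' y v" for u u' v
    using that by (simp add: times_opt_less_iff box_def add.commute)
  have s3: "?f u v < ?f u v'" if "box u x v v'" for u v v'
    using that by (simp add: times_opt_less_iff box_def add.commute)
  have s4: "?f u v' < ?f u v" if "box x u v v'" for u v v'
    using that by (simp add: times_opt_less_iff box_def)
  note simpler = lopt_simpler ropt_simpler
  show ?case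
    unfolding times_wd_def times_unfold[of x y]
  proof (rule is_cut_cut)
    fix l r
    assume l: "l \<in> (\<lambda>(u, v). ?f u v) ` (lopt x \<times> lopt y \<union> ropt x \<times> ropt y)"
      and r: "r \<in> (\<lambda>(u, v). ?f u v) ` (lopt x \<times> ropt y \<union> ropt x \<times> lopt y)"
    obtain u v where uv: "l = ?f u v" "u \<in> lopt x \<and> v \<in> lopt y \<or> u \<in> ropt x \<and> v \<in> ropt y"
      using l by auto
    obtain u' v' where uv': "r = ?f u' v'" "u' \<in> lopt x \<and> v' \<in> ropt y \<or> u' \<in> ropt x \<and> v' \<in> lopt y"
      using r by auto
    \<comment> \<open>Change one coordinate at a time. Where the order of \<open>u\<close> and
      \<open>u'\<close>, or of \<open>v\<close> and \<open>v'\<close>, is unknown, it decides which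
      coordinate moves first so that both steps go upwards.\<close>
    have "?f u v < ?f u' v'"
      using uv(2) uv'(2)
    proof (elim disjE conjE)
      assume *: "u \<in> lopt x" "v \<in> lopt y" "u' \<in> lopt x" "v' \<in> ropt y"
      then have vv: "v < v'" using lopt_ropt_comparable(1) by blast
      show ?thesis
      proof (cases u u' rule: linorder_cases)
        case less
        have "?f u v < ?f u' v" by (intro s1 row simpler less *)
        also have "\<dots> < ?f u' v'" by (intro s3 col vv *; intro simpler *)
        finally show ?thesis .
      next
        case equal
        have "?f u' v < ?f u' v'" by (intro s3 col vv *; intro simpler *)
        then show ?thesis using equal by simp
      next
        case greater
        have "?f u v < ?f u v'" by (intro s3 col vv *; intro simpler *)
        also have "\<dots> < ?f u' v'" by (intro s2 row' simpler greater *)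
        finally show ?thesis .
      qed
    next
      assume *: "u \<in> lopt x" "v \<in> lopt y" "u' \<in> ropt x" "v' \<in> lopt y"
      then have uu: "u < u'" using lopt_ropt_comparable(1) by blast
      show ?thesis
      proof (cases v v' rule: linorder_cases)
        case less
        have "?f u v < ?f u v'" by (intro s3 col less *; intro simpler *)
        also have "\<dots> < ?f u' v'" by (intro s1 row uu *; intro simpler *)
        finally show ?thesis .
      next
        case equal
        have "?f u v < ?f u' v" by (intro s1 row uu *; intro simpler *)
        then show ?thesis using equal by simp
      next
        case greater
        have "?f u v < ?f u' v" by (intro s1 row uu *; intro simpler *)
        also have "\<dots> < ?f u' v'" by (intro s4 col' greater *; intro simpler *)
        finally show ?thesis .
      qed
    next
      assume *: "u \<in> ropt x" "v \<in> ropt y" "u' \<in> lopt x" "v' \<in> ropt y"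
      then have uu: "u' < u" using lopt_ropt_comparable(1) by blast
      show ?thesis
      proof (cases v v' rule: linorder_cases)
        case less
        have "?f u v < ?f u' v" by (intro s2 row' uu *; intro simpler *)
        also have "\<dots> < ?f u' v'" by (intro s3 col less *; intro simpler *)
        finally show ?thesis .
      next
        case equal
        have "?f u v < ?f u' v" by (intro s2 row' uu *; intro simpler *)
        then show ?thesis using equal by simp
      next
        case greater
        have "?f u v < ?f u v'" by (intro s4 col' greater *; intro simpler *)
        also have "\<dots> < ?f u' v'" by (intro s2 row' uu *; intro simpler *)
        finally show ?thesis .
      qed
    next
      assume *: "u \<in> ropt x" "v \<in> ropt y" "u' \<in> ropt x" "v' \<in> lopt y"
      then have vv: "v' < v" using lopt_ropt_comparable(1) by blast
      show ?thesis
      proof (cases u u' rule: linorder_cases)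
        case less
        have "?f u v < ?f u v'" by (intro s4 col' vv *; intro simpler *)
        also have "\<dots> < ?f u' v'" by (intro s1 row less *; intro simpler *)
        finally show ?thesis .
      next
        case equal
        have "?f u v < ?f u v'" by (intro s4 col' vv *; intro simpler *)
        then show ?thesis using equal by simp
      next
        case greater
        have "?f u v < ?f u' v" by (intro s2 row' greater *; intro simpler *)
        also have "\<dots> < ?f u' v'" by (intro s4 col' vv *; intro simpler *)
        finally show ?thesis .
      qed
    qed
    with uv uv' show "l < r" by simp
  qed (intro small_image small_Un small_Times small_lopt small_ropt)+
qed

text \<open>From options to arbitrary pairs by two uses of \<open>strict_mono_optionsI\<close>:
  first in the second argument, with an option \<open>u\<close> of \<open>x\<close> fixed, then in
  the first argument.\<close>

lemma box:
  assumes "u < x" "v < y"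
  shows "box u x v y"
proof -
  have 1: "x * v - u * v < x * y - u * y" if "v < y" "u \<in> lopt x" for u x v y :: "'a surreal"
    by (rule strict_mono_optionsI[where f = "\<lambda>v. x * v - u * v"])
       (use times_wd_box[OF times_wd] that in \<open>auto simp: box_def algebra_simps\<close>)
  have 2: "u * v - x * v < u * y - x * y" if "v < y" "u \<in> ropt x" for u x v y :: "'a surreal"
    by (rule strict_mono_optionsI[where f = "\<lambda>v. u * v - x * v"])
       (use times_wd_box[OF times_wd] that in \<open>auto simp: box_def algebra_simps\<close>)
  have 3: "u * y - u * v < x * y - x * v" if "u \<in> lopt x" for u x
    using 1[OF \<open>v < y\<close> that] by (simp add: algebra_simps)
  have 4: "x * y - x * v < u * y - u * v" if "u \<in> ropt x" for u x
    using 2[OF \<open>v < y\<close> that] by (simp add: algebra_simps)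
  have "u * y - u * v < x * y - x * v"
    by (rule strict_mono_optionsI[where f = "\<lambda>u. u * y - u * v", OF 3 4 assms(1)])
  then show ?thesis by (simp add: box_def algebra_simps)
qed

lemma box_le: "u \<le> x \<Longrightarrow> v \<le> y \<Longrightarrow> u * y + x * v \<le> u * v + x * (y :: 'o::ordinals surreal)"
  using box[of u x v y] by (auto simp: box_def order_le_less)

lemma times_opt_less:
  "u < x \<Longrightarrow> v < y \<Longrightarrow> times_opt x y u v < x * y"
  "x < u \<Longrightarrow> y < v \<Longrightarrow> times_opt x y u v < x * y"
  using box[of u x v y] box[of x u y v] by (auto simp: times_opt_less_iff box_def add.commute)

lemma times_opt_greater:
  "u < x \<Longrightarrow> y < v \<Longrightarrow> x * y < times_opt x y u v"
  "x < u \<Longrightarrow> v < y \<Longrightarrow> x * y < times_opt x y u v"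
  using box[of u x y v] box[of x u v y] by (auto simp: times_opt_less_iff box_def add.commute)

lemma times_opt_mono:
  "u \<le> u' \<Longrightarrow> v \<le> y \<Longrightarrow> times_opt x y u v \<le> times_opt x y u' v"
  "u \<le> u' \<Longrightarrow> y \<le> v \<Longrightarrow> times_opt x y u' v \<le> times_opt x y u v"
  "u \<le> x \<Longrightarrow> v \<le> v' \<Longrightarrow> times_opt x y u v \<le> times_opt x y u v'"
  "x \<le> u \<Longrightarrow> v \<le> v' \<Longrightarrow> times_opt x y u v' \<le> times_opt x y u v"
  using box_le[of u u' v y] box_le[of u u' y v] box_le[of u x v v'] box_le[of x u v v']
  by (auto simp: times_opt_def algebra_simps)

text \<open>Uniformity for products. A pair of options is pushed towards \<open>x\<close> and
  \<open>y\<close> one coordinate at a time; the direction in which \<open>times_opt\<close> moves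
  depends on the side on which the other coordinate lies.\<close>

lemma is_cut_times:
  assumes x: "is_cut x L R" and y: "is_cut y L' R'"
  shows "is_cut (x * y)
     ((\<lambda>(u, v). times_opt x y u v) ` (L \<times> L' \<union> R \<times> R'))
     ((\<lambda>(u, v). times_opt x y u v) ` (L \<times> R' \<union> R \<times> L'))"
    (is "is_cut _ (?f ` ?L) (?f ` ?R)")
proof (rule is_cut_replace[OF times_wd[unfolded times_wd_def]])
  note less = is_cut_less[OF x] is_cut_greater[OF x] is_cut_less[OF y] is_cut_greater[OF y]
  show "l < x * y" if "l \<in> ?f ` ?L" for l
    using that by (auto intro: times_opt_less less)
  show "x * y < r" if "r \<in> ?f ` ?R" for r
    using that by (auto intro: times_opt_greater less)
  show "\<exists>l\<in>?f ` ?L. a \<le> l" if a: "a \<in> ?f ` (lopt x \<times> lopt y \<union> ropt x \<times> ropt y)" for a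
  proof -
    obtain u v where uv: "a = times_opt x y u v"
      "u \<in> lopt x \<and> v \<in> lopt y \<or> u \<in> ropt x \<and> v \<in> ropt y" using a by auto
    from uv(2) show ?thesis
    proof (elim disjE conjE)
      assume *: "u \<in> lopt x" "v \<in> lopt y"
      obtain u' v' where **: "u' \<in> L" "u \<le> u'" "v' \<in> L'" "v \<le> v'"
        using * is_cut_cofinal[OF x] is_cut_cofinal[OF y] by blast
      have "a \<le> times_opt x y u' v"
        unfolding uv using ** lopt_less[OF *(2)] by (intro times_opt_mono(1)) auto
      also have "\<dots> \<le> times_opt x y u' v'"
        using ** less by (intro times_opt_mono(3)) (auto intro: less_imp_le)
      finally show ?thesis using ** by (intro bexI[of _ "times_opt x y u' v'"]) auto
    next
      assume *: "u \<in> ropt x" "v \<in> ropt y"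
      obtain u' v' where **: "u' \<in> R" "u' \<le> u" "v' \<in> R'" "v' \<le> v"
        using * is_cut_coinitial[OF x] is_cut_coinitial[OF y] by blast
      have "a \<le> times_opt x y u' v"
        unfolding uv using ** ropt_greater[OF *(2)] by (intro times_opt_mono(2)) auto
      also have "\<dots> \<le> times_opt x y u' v'"
        using ** less by (intro times_opt_mono(4)) (auto intro: less_imp_le)
      finally show ?thesis using ** by (intro bexI[of _ "times_opt x y u' v'"]) auto
    qed
  qed
  show "\<exists>r\<in>?f ` ?R. r \<le> a" if a: "a \<in> ?f ` (lopt x \<times> ropt y \<union> ropt x \<times> lopt y)" for a
  proof -
    obtain u v where uv: "a = times_opt x y u v"
      "u \<in> lopt x \<and> v \<in> ropt y \<or> u \<in> ropt x \<and> v \<in> lopt y" using a by auto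
    from uv(2) show ?thesis
    proof (elim disjE conjE)
      assume *: "u \<in> lopt x" "v \<in> ropt y"
      obtain u' v' where **: "u' \<in> L" "u \<le> u'" "v' \<in> R'" "v' \<le> v"
        using * is_cut_cofinal[OF x] is_cut_coinitial[OF y] by blast
      have "times_opt x y u' v' \<le> times_opt x y u' v"
        using ** less by (intro times_opt_mono(3)) (auto intro: less_imp_le)
      also have "\<dots> \<le> a"
        unfolding uv using ** ropt_greater[OF *(2)] by (intro times_opt_mono(2)) auto
      finally show ?thesis using ** by (intro bexI[of _ "times_opt x y u' v'"]) auto
    next
      assume *: "u \<in> ropt x" "v \<in> lopt y"
      obtain u' v' where **: "u' \<in> R" "u' \<le> u" "v' \<in> L'" "v \<le> v'"
        using * is_cut_coinitial[OF x] is_cut_cofinal[OF y] by blast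
      have "times_opt x y u' v' \<le> times_opt x y u' v"
        using ** less by (intro times_opt_mono(4)) (auto intro: less_imp_le)
      also have "\<dots> \<le> a"
        unfolding uv using ** lopt_less[OF *(2)] by (intro times_opt_mono(1)) auto
      finally show ?thesis using ** by (intro bexI[of _ "times_opt x y u' v'"]) auto
    qed
  qed
qed

section \<open>The ring laws\<close>

lemma surreal_mult_0_right: "x * 0 = (0 :: 'o::ordinals surreal)"
  using is_cut_times[OF is_cut_canonical[of x] is_cut_0] is_cut_same_eq[OF is_cut_0] by simp

lemma is_cut_1: "is_cut 1 {0} ({} :: 'o::ordinals surreal set)"
  unfolding one_surreal_def
proof (rule is_cut_cut)
  show "small TYPE('o) {0 :: 'o surreal}" using ex_greater by (auto simp: small_def)
qed auto

lemma surreal_mult_1_right: "x * 1 = (x :: 'o::ordinals surreal)"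
proof (induction x rule: surreal_induct)
  case (1 x)
  have "times_opt x 1 u 0 = u" if "simpler u x" for u
    using 1[OF that] by (simp add: times_opt_def surreal_mult_0_right)
  then have "(\<lambda>(u, v). times_opt x 1 u v) ` (A \<times> {0}) = A" if "A = lopt x \<or> A = ropt x" for A
    using that by (force simp: image_iff lopt_simpler ropt_simpler)
  then have "is_cut (x * 1) (lopt x) (ropt x)"
    using is_cut_times[OF is_cut_canonical[of x] is_cut_1] by simp
  then show ?case using is_cut_canonical is_cut_same_eq by blast
qed

text \<open>By uniformity the options of \<open>x * (y + z)\<close> replace \<open>x\<close>
  together with one of \<open>y\<close> and \<open>z\<close>; the induction hypothesis at the
  replaced arguments identifies them with options of the right-hand side, the terms
  \<open>u * z\<close> or \<open>u * y\<close> cancelling.\<close>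

lemma surreal_distrib_left: "x * (y + z) = x * y + x * (z :: 'o::ordinals surreal)"
proof (induction x y z rule: surreal_induct3)
  case (1 x y z)
  have eq1: "times_opt x (y + z) u (v + z) = times_opt x y u v + x * z"
    if "simpler u x" "simpler v y" for u v
    unfolding times_opt_def 1(1)[OF that(1)] 1(2)[OF that(2)] by (simp add: algebra_simps)
  have eq2: "times_opt x (y + z) u (y + w) = x * y + times_opt x z u w"
    if "simpler u x" "simpler w z" for u w
    unfolding times_opt_def 1(1)[OF that(1)] 1(3)[OF that(2)] by (simp add: algebra_simps)
  note l = is_cut_times[OF is_cut_canonical[of x] plus_is_cut_canonical[of y z]]
  note r = is_cut_plus[OF is_cut_times[OF is_cut_canonical[of x] is_cut_canonical[of y]]
      is_cut_times[OF is_cut_canonical[of x] is_cut_canonical[of z]]]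
  note simps = lopt_simpler ropt_simpler
  note intros = times_opt_less times_opt_greater lopt_less ropt_greater
  show ?case
  proof (rule is_cut_unique[OF l r], goal_cases)
    case (1 a)
    then show ?case by (auto simp: simps eq1 eq2) (blast intro: intros)+
  next
    case (2 a)
    then show ?case by (auto simp: simps eq1 eq2) (blast intro: intros)+
  next
    case (3 a)
    then show ?case by (auto simp: simps eq1[symmetric] eq2[symmetric])
        (blast intro: intros add_strict_left_mono add_strict_right_mono)+
  next
    case (4 a)
    then show ?case by (auto simp: simps eq1[symmetric] eq2[symmetric])
        (blast intro: intros add_strict_left_mono add_strict_right_mono)+
  qed
qed

lemma surreal_mult_diff: "x * (y - z) = x * y - x * (z :: 'o::ordinals surreal)"
  using surreal_distrib_left[of x "y - z" z] by simp

lemma surreal_distrib_right: "(x + y) * z = x * z + y * (z :: 'o::ordinals surreal)"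
  using surreal_distrib_left[of z x y] by (simp add: surreal_mult_commute)

lemma surreal_mult_diff_right: "(x - y) * z = x * z - y * (z :: 'o::ordinals surreal)"
  using surreal_mult_diff[of z x y] by (simp add: surreal_mult_commute)

text \<open>The nested options of both sides are the expansion of
  \<open>x * y * z - (x - u) * (y - v) * (z - w)\<close>, in which every product contains a replaced
  factor, so the induction hypothesis applies to each.\<close>

lemma surreal_mult_assoc: "(x * y) * z = x * (y * (z :: 'o::ordinals surreal))"
proof (induction x y z rule: surreal_induct3)
  case (1 x y z)
  have eq: "times_opt (x * y) z (times_opt x y u v) w = times_opt x (y * z) u (times_opt y z v w)"
    if "simpler u x" "simpler v y" "simpler w z" for u v w
    unfolding times_opt_def surreal_mult_diff surreal_mult_diff_right surreal_distrib_left
      surreal_distrib_right 1(1)[OF that(1)] 1(2)[OF that(2)] 1(3)[OF that(3)]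
    by (simp add: algebra_simps)
  note l = is_cut_times[OF is_cut_times[OF is_cut_canonical[of x] is_cut_canonical[of y]] is_cut_canonical[of z]]
  note r = is_cut_times[OF is_cut_canonical[of x] is_cut_times[OF is_cut_canonical[of y] is_cut_canonical[of z]]]
  note simps = lopt_simpler ropt_simpler
  note intros = times_opt_less times_opt_greater lopt_less ropt_greater
  show ?case
  proof (rule is_cut_unique[OF l r], goal_cases)
    case (1 a)
    then show ?case by (auto simp: simps eq) (blast intro: intros)+
  next
    case (2 a)
    then show ?case by (auto simp: simps eq) (blast intro: intros)+
  next
    case (3 a)
    then show ?case by (auto simp: simps eq[symmetric]) (blast intro: intros)+
  next
    case (4 a)
    then show ?case by (auto simp: simps eq[symmetric]) (blast intro: intros)+
  qed
qed

instantiation surreal :: (ordinals) "{abs, sgn}"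
begin

definition abs_surreal :: "'a surreal \<Rightarrow> 'a surreal" where
  "abs_surreal x = (if x < 0 then - x else x)"

definition sgn_surreal :: "'a surreal \<Rightarrow> 'a surreal" where
  "sgn_surreal x = (if x = 0 then 0 else if 0 < x then 1 else - 1)"

instance ..

end

instance surreal :: (ordinals) linordered_idom
proof
  fix a b c :: "'a surreal"
  show "a * b * c = a * (b * c)" by (rule surreal_mult_assoc)
  show "a * b = b * a" by (rule surreal_mult_commute)
  show "1 * a = a" using surreal_mult_1_right surreal_mult_commute by metis
  show "(a + b) * c = a * c + b * c" by (rule surreal_distrib_right)
  show "(0 :: 'a surreal) \<noteq> 1" using is_cut_less[OF is_cut_1, of 0] less_irrefl by (metis insertI1)
  show "c * a < c * b" if "a < b" "0 < c"
    using box[OF that(2,1)]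
    by (simp add: box_def surreal_mult_0_right surreal_mult_commute[of 0])
qed (simp_all add: abs_surreal_def sgn_surreal_def surreal_mult_0_right surreal_mult_commute[of 0])


section \<open>Real numbers\<close>

lemma surreal_of_nat_eq: "surreal_of_nat n = of_nat n"
  by (induction n) (simp_all add: add.commute)

lemma surreal_of_int_eq: "surreal_of_int k = of_int k"
  by (simp add: surreal_of_int_def surreal_of_nat_eq)

lemma small_insert [simp]: "small TYPE('o::ordinals) (insert a A) \<longleftrightarrow> small TYPE('o) A"
proof
  assume A: "small TYPE('o) A"
  have "small TYPE('o) {a}" using ex_greater by (auto simp: small_def)
  from small_Un[OF this A] show "small TYPE('o) (insert a A)" by simp
qed (erule small_subset, blast)

text \<open>A definite description is evaluated by exhibiting its value; \<open>dyadic_unit\<close>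
  will do so for the powers of 2.\<close>

lemma inverse_eqI:
  assumes "x * y = (1 :: 'o::ordinals surreal)" shows "inverse x = y"
proof -
  have "(THE y. x * y = 1) = y"
  proof (rule the_equality[where P = "\<lambda>y. x * y = 1", OF assms])
    fix z assume z: "x * z = 1"
    have "z = z * (x * y)" using assms by simp
    also have "\<dots> = (x * z) * y" by (simp only: ac_simps)
    finally show "z = y" using z by simp
  qed
  moreover have "x \<noteq> 0" using assms by auto
  ultimately show ?thesis by (simp add: inverse_surreal_def)
qed

lemma is_cut_uminus:
  assumes "is_cut x L R" shows "is_cut (- x) (uminus ` R) (uminus ` L)"
  by (rule is_cutI)
     (use is_cut_less[OF assms] is_cut_greater[OF assms] is_cut_cofinal[OF assms] is_cut_coinitial[OF assms]
      in \<open>auto simp: lopt_uminus ropt_uminus\<close>)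

section \<open>Integers and dyadic rationals as cuts\<close>

lemma is_cut_Suc: "is_cut (of_nat (Suc n)) {of_nat n} ({} :: 'o::ordinals surreal set)"
proof (induction n)
  case 0
  show ?case using is_cut_1 by simp
next
  case (Suc n)
  from is_cut_plus[OF this is_cut_1] show ?case by (simp add: algebra_simps)
qed

lemma is_cut_of_int: "is_cut (of_int k :: 'o::ordinals surreal) {of_int (k - 1)} {of_int (k + 1)}"
proof (cases k rule: int_cases3)
  case zero
  then show ?thesis using is_cut_replace[OF is_cut_0, of "{-1}" "{1}"] by simp
next
  case (pos n)
  then obtain m where m: "n = Suc m" by (cases n) auto
  have k: "of_int k = (of_nat (Suc m) :: 'o surreal)" using pos m by simp
  show ?thesis
    unfolding of_int_add of_int_diff k by (rule is_cut_replace[OF is_cut_Suc]) auto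
next
  case (neg n)
  then obtain m where m: "n = Suc m" by (cases n) auto
  have k: "of_int k = (- of_nat (Suc m) :: 'o surreal)" using neg m by simp
  show ?thesis
    unfolding of_int_add of_int_diff k by (rule is_cut_replace[OF is_cut_uminus[OF is_cut_Suc]]) auto
qed

text \<open>Halving without division: the options \<open>p + z\<close> and \<open>q + z\<close> of
  \<open>z + z\<close> enclose \<open>p + q\<close>, and \<open>z + z\<close> lies between
  \<open>p + p\<close> and \<open>q + q\<close>, so the two numbers lie in each other's
  cuts.\<close>

lemma cut_midpoint:
  fixes p q :: "'o::ordinals surreal"
  assumes "is_cut (p + q) {p + p} {q + q}"
  obtains z where "is_cut z {p} {q}" "z + z = p + q"
proof -
  have "p < q" using is_cut_less[OF assms] by auto
  then have z: "is_cut (cut {p} {q}) {p} {q}" by (intro is_cut_cut) auto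
  define z where "z = cut {p} {q}"
  have pz: "p < z" "z < q" using is_cut_less[OF z] is_cut_greater[OF z] by (auto simp: z_def)
  have "z + z = p + q"
    by (rule is_cut_unique[OF is_cut_plus[OF z z, folded z_def] assms])
       (use pz in \<open>auto simp: algebra_simps intro: add_strict_mono\<close>)
  then show ?thesis using that z z_def by blast
qed

lemma double_eq_iff: "x + x = y + y \<longleftrightarrow> x = (y :: 'a::linordered_idom)"
  by (simp flip: mult_2)

text \<open>Here \<open>h\<close> is the inverse of \<open>2 ^ n\<close>. With \<open>z\<close> half
  of \<open>h\<close>, the statement for \<open>k\<close> at level \<open>n\<close> is exactly the
  hypothesis of \<open>cut_midpoint\<close> for \<open>(k - 1) * z\<close> and
  \<open>(k + 1) * z\<close>, whose midpoint is \<open>k * z\<close>. The case \<open>k = 1\<close>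
  produces \<open>z\<close> itself.\<close>

lemma dyadic_unit:
  "\<exists>h :: 'o::ordinals surreal. 2 ^ n * h = 1 \<and>
     (\<forall>k. odd k \<longrightarrow> is_cut (of_int k * h) {of_int (k - 1) * h} {of_int (k + 1) * h})"
proof (induction n)
  case 0
  show ?case using is_cut_of_int[where 'o = 'o] by (intro exI[of _ 1]) simp
next
  case (Suc n)
  then obtain h :: "'o surreal" where h: "2 ^ n * h = 1"
    and cut: "\<And>k. odd k \<Longrightarrow> is_cut (of_int k * h) {of_int (k - 1) * h} {of_int (k + 1) * h}"
    by blast
  have "is_cut (0 + h) {0 + 0} {h + h}" using cut[of 1] by (simp flip: mult_2)
  then obtain z where "z + z = 0 + h" by (rule cut_midpoint)
  then have z: "z + z = h" by simp
  have "2 ^ Suc n * z = 1" using h unfolding z[symmetric] by (simp add: algebra_simps)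
  moreover have "is_cut (of_int k * z) {of_int (k - 1) * z} {of_int (k + 1) * z}" if "odd k" for k
  proof -
    have "is_cut (of_int (k - 1) * z + of_int (k + 1) * z)
        {of_int (k - 1) * z + of_int (k - 1) * z} {of_int (k + 1) * z + of_int (k + 1) * z}"
      using cut[OF that] unfolding z[symmetric] by (simp add: algebra_simps)
    then obtain w where w: "is_cut w {of_int (k - 1) * z} {of_int (k + 1) * z}"
      "w + w = of_int (k - 1) * z + of_int (k + 1) * z" by (rule cut_midpoint)
    have "w + w = of_int k * z + of_int k * z" using w(2) by (simp add: algebra_simps)
    then have "w = of_int k * z" by (rule double_eq_iff[THEN iffD1])
    with w(1) show ?thesis by blast
  qed
  ultimately show ?case by blast
qed

lemma power_2_mult_inverse: "2 ^ n * inverse (2 ^ n) = (1 :: 'o::ordinals surreal)"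
  using dyadic_unit[of n] inverse_eqI by metis

lemma is_cut_odd_dyadic:
  "odd k \<Longrightarrow> is_cut (of_int k / 2 ^ n :: 'o::ordinals surreal) {of_int (k - 1) / 2 ^ n} {of_int (k + 1) / 2 ^ n}"
  using dyadic_unit[of n] inverse_eqI unfolding divide_surreal_def by metis

lemma dyadic_times_power_2: "of_int k / 2 ^ n * 2 ^ n = (of_int k :: 'o::ordinals surreal)"
  using power_2_mult_inverse[of n, where 'o = 'o] by (simp add: divide_surreal_def mult.assoc mult.commute)

lemma power_2_cancel: "x * 2 ^ n = y * 2 ^ n \<longleftrightarrow> x = (y :: 'o::ordinals surreal)"
  by simp

lemma dyadic_less_iff:
  "(of_int k / 2 ^ n :: 'o::ordinals surreal) < of_int j / 2 ^ m \<longleftrightarrow>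
   (of_int k / 2 ^ n :: real) < of_int j / 2 ^ m"
proof -
  have "(of_int k / 2 ^ n :: 'o surreal) < of_int j / 2 ^ m \<longleftrightarrow>
    (of_int k / 2 ^ n :: 'o surreal) * 2 ^ n * 2 ^ m < of_int j / 2 ^ m * 2 ^ m * 2 ^ n"
    by (simp add: mult.assoc mult.commute[of "2 ^ m" "2 ^ n"])
  also have "\<dots> \<longleftrightarrow> (of_int (k * 2 ^ m) :: 'o surreal) < of_int (j * 2 ^ n)"
    by (simp add: dyadic_times_power_2)
  also have "\<dots> \<longleftrightarrow> (of_int (k * 2 ^ m) :: real) < of_int (j * 2 ^ n)"
    by (simp only: of_int_less_iff)
  also have "\<dots> \<longleftrightarrow> (of_int k / 2 ^ n :: real) < of_int j / 2 ^ m"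
    by (simp add: field_simps)
  finally show ?thesis .
qed

lemma dyadic_eq_iff:
  "(of_int k / 2 ^ n :: 'o::ordinals surreal) = of_int j / 2 ^ m \<longleftrightarrow>
   (of_int k / 2 ^ n :: real) = of_int j / 2 ^ m"
proof -
  let ?x = "of_int k / 2 ^ n :: 'o surreal" and ?y = "of_int j / 2 ^ m :: 'o surreal"
  have "?x < ?y \<or> ?y < ?x \<longleftrightarrow> (of_int k / 2 ^ n :: real) < of_int j / 2 ^ m \<or>
    (of_int j / 2 ^ m :: real) < of_int k / 2 ^ n"
    by (simp only: dyadic_less_iff)
  then show ?thesis unfolding linorder_neq_iff[symmetric] by (simp only: not_not simp_thms)
qed

definition dyadics :: "real set" where
  "dyadics = {of_int k / 2 ^ n | k n. True}"

lemma dyadicI: "of_int k / 2 ^ n \<in> dyadics"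
  by (auto simp: dyadics_def)

lemma dyadicE:
  assumes "d \<in> dyadics" obtains k n where "d = of_int k / 2 ^ n"
  using assms by (auto simp: dyadics_def)

text \<open>Cuts by neighbours are at hand for integers and for odd numerators; an even numerator is
  halved until one of these cases is reached.\<close>

lemma dyadic_is_cut:
  assumes "d \<in> dyadics"
  obtains k n where "d = of_int k / 2 ^ n"
    "is_cut (of_int k / 2 ^ n :: 'o::ordinals surreal) {of_int (k - 1) / 2 ^ n} {of_int (k + 1) / 2 ^ n}"
proof -
  have "\<exists>k n. of_int j / 2 ^ m = (of_int k / 2 ^ n :: real) \<and>
    is_cut (of_int k / 2 ^ n :: 'o surreal) {of_int (k - 1) / 2 ^ n} {of_int (k + 1) / 2 ^ n}" for j m
  proof (induction m arbitrary: j)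
    case 0
    have "inverse 1 = (1 :: 'o surreal)" by (rule inverse_eqI) simp
    then show ?case using is_cut_of_int[of j]
      by (intro exI[of _ j] exI[of _ 0]) (simp add: divide_surreal_def)
  next
    case (Suc m)
    show ?case
    proof (cases "odd j")
      case True
      then show ?thesis using is_cut_odd_dyadic by blast
    next
      case False
      then obtain i where "j = 2 * i" by (auto elim: evenE)
      then have "of_int j / 2 ^ Suc m = (of_int i / 2 ^ m :: real)" by simp
      then show ?thesis using Suc[of i] by simp
    qed
  qed
  then show ?thesis using assms that by (auto simp: dyadics_def)
qed

lemma surreal_of_real_cut_eq:
  "surreal_of_real r = cut {of_int k / 2 ^ n | k n. of_int k / 2 ^ n < r} {of_int k / 2 ^ n | k n. r < of_int k / 2 ^ n}"
  by (simp only: surreal_of_real_def surreal_of_int_eq surreal_of_nat_eq of_nat_numeral)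

text \<open>The two neighbours are among the dyadics below and above, so enlarging the options to
  all of these leaves the cut unchanged.\<close>

lemma surreal_of_real_dyadic:
  "surreal_of_real (of_int k / 2 ^ n) = (of_int k / 2 ^ n :: 'o::ordinals surreal)"
proof -
  obtain j m where jm: "of_int k / 2 ^ n = (of_int j / 2 ^ m :: real)"
    and c: "is_cut (of_int j / 2 ^ m :: 'o surreal) {of_int (j - 1) / 2 ^ m} {of_int (j + 1) / 2 ^ m}"
    using dyadic_is_cut[OF dyadicI] by metis
  have eq: "(of_int k / 2 ^ n :: 'o surreal) = of_int j / 2 ^ m" using jm dyadic_eq_iff by blast
  show ?thesis
    unfolding surreal_of_real_cut_eq jm eq
  proof (rule cut_eqI, rule is_cut_replace[OF c], goal_cases)
    case (3 a)
    have "(of_int (j - 1) / 2 ^ m :: real) < of_int j / 2 ^ m" by (simp add: divide_simps)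
    with 3 show ?case by blast
  next
    case (4 a)
    have "(of_int j / 2 ^ m :: real) < of_int (j + 1) / 2 ^ m" by (simp add: divide_simps)
    with 4 show ?case by blast
  qed (auto simp: dyadic_less_iff)
qed

lemma surreal_of_real_less_dyadics:
  assumes "d \<in> dyadics" "e \<in> dyadics"
  shows "surreal_of_real d < (surreal_of_real e :: 'o::ordinals surreal) \<longleftrightarrow> d < e"
  using assms by (auto elim!: dyadicE simp: surreal_of_real_dyadic dyadic_less_iff)

text \<open>The options are images of dyadics, whose order is already known, and there are only
  countably many of them, so the cut exists.\<close>

lemma is_cut_of_real:
  "is_cut (surreal_of_real r :: 'o::ordinals surreal)
     (surreal_of_real ` {d \<in> dyadics. d < r}) (surreal_of_real ` {d \<in> dyadics. r < d})"
proof -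
  have small: "small TYPE('o) (surreal_of_real ` {d \<in> dyadics. P d} :: 'o surreal set)" for P
  proof (rule small_subset[OF small_countable])
    show "surreal_of_real ` {d \<in> dyadics. P d} \<subseteq>
      range (\<lambda>(k :: int, n :: nat). surreal_of_real (of_int k / 2 ^ n) :: 'o surreal)"
      by (auto elim!: dyadicE)
  qed
  have eq: "{of_int k / 2 ^ n | k n. P (of_int k / 2 ^ n)} =
    (surreal_of_real ` {d \<in> dyadics. P d} :: 'o surreal set)" for P
  proof -
    have "{of_int k / 2 ^ n | k n. P (of_int k / 2 ^ n)} =
      {surreal_of_real (of_int k / 2 ^ n) :: 'o surreal | k n. P (of_int k / 2 ^ n)}"
      by (simp only: surreal_of_real_dyadic)
    also have "\<dots> = surreal_of_real ` {d \<in> dyadics. P d}"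
      unfolding dyadics_def by blast
    finally show ?thesis .
  qed
  show ?thesis
    unfolding surreal_of_real_cut_eq[of r] eq[of "\<lambda>d. d < r"] eq[of "\<lambda>d. r < d"]
  proof (rule is_cut_cut[OF small small])
    show "l < u" if "l \<in> surreal_of_real ` {d \<in> dyadics. d < r}"
      "u \<in> surreal_of_real ` {d \<in> dyadics. r < d}" for l u :: "'o surreal"
      using that by (auto simp: surreal_of_real_less_dyadics)
  qed
qed

section \<open>Standard parts and the arithmetic of real numbers\<close>

lemma dyadic_dense:
  fixes r s :: real
  assumes "r < s" obtains d where "d \<in> dyadics" "r < d" "d < s"
proof -
  obtain n where n: "inverse (s - r) < 2 ^ n"
    using real_arch_pow[of 2 "inverse (s - r)"] by auto
  have 1: "1 < (s - r) * 2 ^ n" using n assms by (simp add: field_simps)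
  define k where "k = \<lfloor>r * 2 ^ n\<rfloor> + 1"
  have "r * 2 ^ n < of_int k" "of_int k \<le> r * 2 ^ n + 1" by (auto simp: k_def)
  then have "r < of_int k / 2 ^ n" "of_int k / 2 ^ n < s" using 1 by (auto simp: field_simps)
  then show ?thesis using that dyadicI by blast
qed

text \<open>\<open>near x r\<close> says that \<open>x\<close> is finite with standard part \<open>r\<close>.\<close>

definition near :: "'o::ordinals surreal \<Rightarrow> real \<Rightarrow> bool" where
  "near x r \<longleftrightarrow> (\<forall>d\<in>dyadics. (d < r \<longrightarrow> surreal_of_real d < x) \<and> (r < d \<longrightarrow> x < surreal_of_real d))"

lemma nearI:
  assumes "\<And>d. d \<in> dyadics \<Longrightarrow> d < r \<Longrightarrow> surreal_of_real d < x"
    and "\<And>d. d \<in> dyadics \<Longrightarrow> r < d \<Longrightarrow> x < surreal_of_real d"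
  shows "near x r"
  using assms by (simp add: near_def)

lemma nearD:
  assumes "near x r" "d \<in> dyadics"
  shows "d < r \<Longrightarrow> surreal_of_real d < x" and "r < d \<Longrightarrow> x < surreal_of_real d"
  using assms by (simp_all add: near_def)

lemma near_of_real: "near (surreal_of_real r) r"
  by (rule nearI) (auto intro: is_cut_less[OF is_cut_of_real] is_cut_greater[OF is_cut_of_real])

lemma near_less:
  assumes "near x r" "near y s" "r < s" shows "x < y"
proof -
  obtain d where "d \<in> dyadics" "r < d" "d < s" using dyadic_dense[OF \<open>r < s\<close>] .
  then show ?thesis using nearD(2)[OF assms(1)] nearD(1)[OF assms(2)] by (blast intro: less_trans)
qed

lemma dyadics_add: "d \<in> dyadics \<Longrightarrow> e \<in> dyadics \<Longrightarrow> d + e \<in> dyadics"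
  and dyadics_mult: "d \<in> dyadics \<Longrightarrow> e \<in> dyadics \<Longrightarrow> d * e \<in> dyadics"
  and dyadics_uminus: "d \<in> dyadics \<Longrightarrow> - d \<in> dyadics"
proof -
  assume "d \<in> dyadics" "e \<in> dyadics"
  then obtain k n j m where *: "d = of_int k / 2 ^ n" "e = of_int j / 2 ^ m" by (auto elim!: dyadicE)
  have "d + e = of_int (k * 2 ^ m + j * 2 ^ n) / 2 ^ (n + m)" "d * e = of_int (k * j) / 2 ^ (n + m)"
    unfolding * by (simp_all add: field_simps power_add)
  then show "d + e \<in> dyadics" "d * e \<in> dyadics" using dyadicI by metis+
next
  assume "d \<in> dyadics"
  then obtain k n where "d = of_int k / 2 ^ n" by (auto elim!: dyadicE)
  then have "- d = of_int (- k) / 2 ^ n" by simp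
  then show "- d \<in> dyadics" using dyadicI by metis
qed

lemma surreal_of_real_dyadic_hom:
  assumes "d \<in> dyadics" "e \<in> dyadics"
  shows "surreal_of_real (d + e) = surreal_of_real d + (surreal_of_real e :: 'o::ordinals surreal)"
    and "surreal_of_real (d * e) = surreal_of_real d * (surreal_of_real e :: 'o surreal)"
proof -
  obtain k n j m where *: "d = of_int k / 2 ^ n" "e = of_int j / 2 ^ m"
    using assms by (auto elim!: dyadicE)
  define x y :: "'o surreal" where "x = of_int k / 2 ^ n" and "y = of_int j / 2 ^ m"
  have x: "x * 2 ^ n = of_int k" and y: "y * 2 ^ m = of_int j"
    by (simp_all add: x_def y_def dyadic_times_power_2)
  have 1: "d + e = of_int (k * 2 ^ m + j * 2 ^ n) / 2 ^ (n + m)" "d * e = of_int (k * j) / 2 ^ (n + m)"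
    unfolding * by (simp_all add: field_simps power_add)
  have "surreal_of_real (d + e) * 2 ^ (n + m) = (of_int (k * 2 ^ m + j * 2 ^ n) :: 'o surreal)"
    "surreal_of_real (d * e) * 2 ^ (n + m) = (of_int (k * j) :: 'o surreal)"
    unfolding 1 surreal_of_real_dyadic dyadic_times_power_2 by (rule refl)+
  moreover have "(of_int (k * 2 ^ m + j * 2 ^ n) :: 'o surreal) = (x + y) * 2 ^ (n + m)"
    "(of_int (k * j) :: 'o surreal) = x * y * 2 ^ (n + m)"
    unfolding of_int_add of_int_mult x[symmetric] y[symmetric] by (simp_all add: algebra_simps power_add)
  ultimately have "surreal_of_real (d + e) * 2 ^ (n + m) = (x + y) * 2 ^ (n + m)"
    "surreal_of_real (d * e) * 2 ^ (n + m) = x * y * 2 ^ (n + m)" by simp_all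
  then show "surreal_of_real (d + e) = surreal_of_real d + (surreal_of_real e :: 'o surreal)"
    "surreal_of_real (d * e) = surreal_of_real d * (surreal_of_real e :: 'o surreal)"
    unfolding power_2_cancel * surreal_of_real_dyadic x_def y_def by blast+
qed

lemma of_int_dyadic: "of_int k \<in> dyadics"
  using dyadicI[of k 0] by simp

lemma surreal_of_real_of_int: "surreal_of_real (of_int k) = (of_int k :: 'o::ordinals surreal)"
  using surreal_of_real_dyadic[of k 0, where 'o = 'o] dyadic_times_power_2[of k 0, where 'o = 'o] by simp

lemma surreal_of_real_0 [simp]: "surreal_of_real 0 = 0"
  and surreal_of_real_1 [simp]: "surreal_of_real 1 = 1"
  using surreal_of_real_of_int[of 0] surreal_of_real_of_int[of 1] by simp_all

lemma surreal_of_real_of_nat: "surreal_of_real (of_nat n) = (of_nat n :: 'o::ordinals surreal)"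
  using surreal_of_real_of_int[of "int n"] by simp

lemma surreal_of_real_uminus_dyadic:
  "d \<in> dyadics \<Longrightarrow> surreal_of_real (- d) = (- surreal_of_real d :: 'o::ordinals surreal)"
  using surreal_of_real_dyadic_hom(1)[OF dyadics_uminus[of d], of d]
  by (simp add: eq_neg_iff_add_eq_0)

lemma near_add:
  assumes x: "near x r" and y: "near (y :: 'o::ordinals surreal) s" shows "near (x + y) (r + s)"
proof (rule nearI)
  fix e assume e: "e \<in> dyadics" "e < r + s"
  have "e - s < r" using e by simp
  then obtain d where d: "d \<in> dyadics" "e - s < d" "d < r" by (rule dyadic_dense)
  have "e - d < s" using d by simp
  then obtain d' where d': "d' \<in> dyadics" "e - d < d'" "d' < s" by (rule dyadic_dense)
  have "surreal_of_real e < (surreal_of_real (d + d') :: 'o surreal)"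
    using d d' e by (subst surreal_of_real_less_dyadics) (auto intro: dyadics_add)
  also have "\<dots> < x + y"
    unfolding surreal_of_real_dyadic_hom(1)[OF d(1) d'(1)]
    by (intro add_strict_mono nearD[OF x] nearD[OF y] d d')
  finally show "surreal_of_real e < x + y" .
next
  fix e assume e: "e \<in> dyadics" "r + s < e"
  have "r < e - s" using e by simp
  then obtain d where d: "d \<in> dyadics" "r < d" "d < e - s" by (rule dyadic_dense)
  have "s < e - d" using d by simp
  then obtain d' where d': "d' \<in> dyadics" "s < d'" "d' < e - d" by (rule dyadic_dense)
  have "x + y < surreal_of_real (d + d')"
    unfolding surreal_of_real_dyadic_hom(1)[OF d(1) d'(1)]
    by (intro add_strict_mono nearD[OF x] nearD[OF y] d d')
  also have "\<dots> < (surreal_of_real e :: 'o surreal)"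
    using d d' e by (subst surreal_of_real_less_dyadics) (auto intro: dyadics_add)
  finally show "x + y < surreal_of_real e" .
qed

lemma near_uminus: "near x r \<Longrightarrow> near (- x) (- r)"
proof (rule nearI)
  assume x: "near x r"
  show "surreal_of_real d < - x" if "d \<in> dyadics" "d < - r" for d
    using nearD(2)[OF x dyadics_uminus[OF that(1)]] that
    by (simp add: surreal_of_real_uminus_dyadic less_minus_iff)
  show "- x < surreal_of_real d" if "d \<in> dyadics" "- r < d" for d
    using nearD(1)[OF x dyadics_uminus[OF that(1)]] that
    by (simp add: surreal_of_real_uminus_dyadic minus_less_iff)
qed

lemma near_diff: "near x r \<Longrightarrow> near y s \<Longrightarrow> near (x - y) (r - s)"
  using near_add[of x r "- y" "- s"] near_uminus[of y s] by simp

lemma near_0: "near 0 0" and near_of_nat: "near (of_nat n) (of_nat n)"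
  using near_of_real[of 0] near_of_real[of "of_nat n"] by (simp_all add: surreal_of_real_of_nat)

lemma near_mult_pos:
  assumes x: "near x r" and y: "near (y :: 'o::ordinals surreal) s" and "0 < r" "0 < s"
  shows "near (x * y) (r * s)"
proof (rule nearI)
  fix e assume e: "e \<in> dyadics" "e < r * s"
  \<comment> \<open>A dyadic \<open>c\<close> between \<open>e / s\<close> and \<open>r\<close>
    leaves room for a dyadic \<open>d\<close> between \<open>e / c\<close> and \<open>s\<close>, so
    that \<open>e < c * d\<close>. The maximum keeps both positive, as division by \<open>c\<close>
    and monotonicity of products require.\<close>
  have "max 0 (e / s) < r" using e assms by (simp add: field_simps)
  then obtain c where c: "c \<in> dyadics" "max 0 (e / s) < c" "c < r" by (rule dyadic_dense)
  have "max 0 (e / c) < s" using c assms by (simp add: field_simps)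
  then obtain d where d: "d \<in> dyadics" "max 0 (e / c) < d" "d < s" by (rule dyadic_dense)
  have "surreal_of_real e < (surreal_of_real (c * d) :: 'o surreal)"
    using c d e by (subst surreal_of_real_less_dyadics) (auto intro: dyadics_mult simp: field_simps)
  also have "\<dots> < x * y"
    unfolding surreal_of_real_dyadic_hom(2)[OF c(1) d(1)]
    using c d by (intro mult_strict_mono' nearD[OF x] nearD[OF y] less_imp_le[OF near_less[OF near_0 near_of_real]]) auto
  finally show "surreal_of_real e < x * y" .
next
  fix e assume e: "e \<in> dyadics" "r * s < e"
  have "r < e / s" using e assms by (simp add: field_simps)
  then obtain c where c: "c \<in> dyadics" "r < c" "c < e / s" by (rule dyadic_dense)
  then have "0 < c" using assms by simp
  have "s < e / c" using c assms by (simp add: field_simps)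
  then obtain d where d: "d \<in> dyadics" "s < d" "d < e / c" by (rule dyadic_dense)
  have "x * y < surreal_of_real (c * d)"
    unfolding surreal_of_real_dyadic_hom(2)[OF c(1) d(1)]
    using c d assms by (intro mult_strict_mono' nearD[OF x] nearD[OF y]
      less_imp_le[OF near_less[OF near_0 x]] less_imp_le[OF near_less[OF near_0 y]]) auto
  also have "\<dots> < (surreal_of_real e :: 'o surreal)"
    using c d e \<open>0 < c\<close> by (subst surreal_of_real_less_dyadics) (auto intro: dyadics_mult simp: field_simps)
  finally show "x * y < surreal_of_real e" .
qed

lemma near_of_nat_mult: "near x r \<Longrightarrow> near (of_nat n * x) (of_nat n * r)"
proof (induction n)
  case (Suc n)
  then show ?case using near_add[of x r "of_nat n * x" "of_nat n * r"] by (simp add: algebra_simps)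
qed (simp add: near_0)

text \<open>Adding a large natural number makes both factors positive; the correction terms are
  multiples by a natural number, that is, repeated sums.\<close>

lemma near_mult:
  assumes x: "near x r" and y: "near (y :: 'o::ordinals surreal) s" shows "near (x * y) (r * s)"
proof -
  obtain n :: nat where n: "max (- r) (- s) < of_nat n" using reals_Archimedean2 by blast
  let ?n = "of_nat n :: 'o surreal"
  have "near ((x + ?n) * (y + ?n) - ?n * x - ?n * y - ?n * ?n)
    ((r + of_nat n) * (s + of_nat n) - of_nat n * r - of_nat n * s - of_nat n * of_nat n)"
    using n by (intro near_diff near_mult_pos near_add near_of_nat near_of_nat_mult x y) auto
  then show ?thesis by (simp add: algebra_simps)
qed

text \<open>All inequalities required by \<open>is_cut_unique\<close> are between numbers with
  different standard parts.\<close>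

lemma surreal_of_real_add:
  "surreal_of_real (r + s) = surreal_of_real r + (surreal_of_real s :: 'o::ordinals surreal)"
proof -
  have near: "near (surreal_of_real a + surreal_of_real b :: 'o surreal) (a + b)" for a b
    by (intro near_add near_of_real)
  have "surreal_of_real a + surreal_of_real b < (surreal_of_real c :: 'o surreal)" if "a + b < c" for a b c
    by (rule near_less[OF near near_of_real that])
  moreover have "surreal_of_real c < (surreal_of_real a + surreal_of_real b :: 'o surreal)" if "c < a + b" for a b c
    by (rule near_less[OF near_of_real near that])
  ultimately show ?thesis
    by (intro is_cut_unique[OF is_cut_of_real is_cut_plus[OF is_cut_of_real is_cut_of_real]]) auto
qed

text \<open>The standard part of the option at \<open>d\<close>, \<open>e\<close> falls short of
  \<open>r * s\<close> by \<open>(r - d) * (s - e)\<close>, so its side can be read off from a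
  sign.\<close>

lemma surreal_of_real_mult:
  "surreal_of_real (r * s) = surreal_of_real r * (surreal_of_real s :: 'o::ordinals surreal)"
proof -
  have near: "near (times_opt (surreal_of_real r) (surreal_of_real s) (surreal_of_real d) (surreal_of_real e))
    (d * s + r * e - d * e)" for d e
    unfolding times_opt_def by (intro near_diff near_add near_mult near_of_real)
  have 1: "times_opt (surreal_of_real r) (surreal_of_real s) (surreal_of_real d) (surreal_of_real e)
      < (surreal_of_real (r * s) :: 'o surreal)" if "d < r \<and> e < s \<or> r < d \<and> s < e" for d e
  proof (rule near_less[OF near near_of_real])
    have "0 < (r - d) * (s - e)" using that by (auto intro: mult_pos_pos mult_neg_neg)
    then show "d * s + r * e - d * e < r * s" by (simp add: algebra_simps)
  qed
  have 2: "(surreal_of_real (r * s) :: 'o surreal)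
      < times_opt (surreal_of_real r) (surreal_of_real s) (surreal_of_real d) (surreal_of_real e)"
    if "d < r \<and> s < e \<or> r < d \<and> e < s" for d e
  proof (rule near_less[OF near_of_real near])
    have "(r - d) * (s - e) < 0" using that by (auto intro: mult_pos_neg mult_neg_pos)
    then show "r * s < d * s + r * e - d * e" by (simp add: algebra_simps)
  qed
  have "near (surreal_of_real r * (surreal_of_real s :: 'o surreal)) (r * s)"
    by (intro near_mult near_of_real)
  then show ?thesis
    by (intro is_cut_unique[OF is_cut_of_real is_cut_times[OF is_cut_of_real is_cut_of_real]])
       (auto intro: 1 2 nearD)
qed

lemma surreal_of_real_less_iff [simp]:
  "surreal_of_real r < (surreal_of_real s :: 'o::ordinals surreal) \<longleftrightarrow> r < s"
proof -
  have *: "surreal_of_real a < (surreal_of_real b :: 'o surreal)" if "a < b" for a b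
    by (rule near_less[OF near_of_real near_of_real that])
  show ?thesis using *[of r s] *[of s r] by (cases r s rule: linorder_cases) auto
qed

lemma surreal_of_real_eq_iff [simp]:
  "surreal_of_real r = (surreal_of_real s :: 'o::ordinals surreal) \<longleftrightarrow> r = s"
proof
  assume "surreal_of_real r = (surreal_of_real s :: 'o surreal)"
  then have "\<not> surreal_of_real r < (surreal_of_real s :: 'o surreal)"
    "\<not> surreal_of_real s < (surreal_of_real r :: 'o surreal)" by simp_all
  then show "r = s" unfolding surreal_of_real_less_iff by simp
qed simp

lemma surreal_of_real_uminus: "surreal_of_real (- r) = (- surreal_of_real r :: 'o::ordinals surreal)"
  using surreal_of_real_add[of "- r" r, where 'o = 'o] by (simp add: eq_neg_iff_add_eq_0)

lemma surreal_of_real_diff: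
  "surreal_of_real (r - s) = surreal_of_real r - (surreal_of_real s :: 'o::ordinals surreal)"
  using surreal_of_real_add[of r "- s"] by (simp add: surreal_of_real_uminus)

lemma surreal_of_real_power: "surreal_of_real (r ^ n) = (surreal_of_real r ^ n :: 'o::ordinals surreal)"
  by (induction n) (simp_all add: surreal_of_real_mult)

lemma surreal_of_real_inverse:
  "surreal_of_real (inverse r) = inverse (surreal_of_real r :: 'o::ordinals surreal)"
proof (cases "r = 0")
  case True
  then show ?thesis by (simp add: inverse_surreal_def)
next
  case False
  then have "surreal_of_real r * surreal_of_real (inverse r) = (1 :: 'o surreal)"
    by (simp flip: surreal_of_real_mult)
  then show ?thesis by (rule inverse_eqI[symmetric])
qed

lemma surreal_of_real_divide:
  "surreal_of_real (r / s) = surreal_of_real r / (surreal_of_real s :: 'o::ordinals surreal)"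
  by (simp add: divide_inverse divide_surreal_def surreal_of_real_mult surreal_of_real_inverse)

section \<open>Initial segments of real numbers are real\<close>

lemma simpler_of_nat:
  "simpler u (of_nat n :: 'o::ordinals surreal) \<Longrightarrow> \<exists>m. u = of_nat m"
proof (induction n)
  case 0
  then show ?case using is_cut_0 by (auto simp: is_cut_def)
next
  case (Suc n)
  then have "u \<le> of_nat n" using is_cut_Suc[of n] unfolding is_cut_def by blast
  then have "u = of_nat n \<or> simpler u (of_nat n)"
    by (intro simpler_between[OF Suc.prems]) auto
  then show ?case using Suc.IH by blast
qed

text \<open>An initial segment falls outside the cut by the two neighbours, so
  \<open>simpler_between\<close> makes it equal to or simpler than one of them. The neighbours of an
  odd fraction have even numerators and reduce to the preceding denominator.\<close>

lemma simpler_dyadic: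
  "simpler u (of_int k / 2 ^ n :: 'o::ordinals surreal) \<Longrightarrow> u \<in> surreal_of_real ` dyadics"
proof (induction n arbitrary: k)
  case 0
  then have u: "simpler u (of_int k)"
    using surreal_of_real_dyadic[of k 0, where 'o = 'o] by (simp add: surreal_of_real_of_int)
  have "\<exists>j. u = of_int j"
  proof (cases k rule: int_cases2)
    case (nonneg m)
    then show ?thesis using u simpler_of_nat by (metis of_int_of_nat_eq)
  next
    case (nonpos m)
    then have "simpler (- u) (of_nat m)" using u simpler_uminus[of u "of_int k"] by simp
    then obtain j where "- u = of_nat j" using simpler_of_nat by blast
    then have "u = of_int (- int j)" by (metis add.inverse_inverse of_int_minus of_int_of_nat_eq)
    then show ?thesis by blast
  qed
  then show ?case using surreal_of_real_of_int of_int_dyadic by (metis image_eqI)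
next
  case (Suc n)
  have even: "u \<in> surreal_of_real ` dyadics"
    if "u = of_int j / 2 ^ Suc n \<or> simpler u (of_int j / 2 ^ Suc n)" "even j" for j
  proof -
    obtain i where "j = 2 * i" using \<open>even j\<close> by (auto elim: evenE)
    then have "of_int j / 2 ^ Suc n = (of_int i / 2 ^ n :: 'o surreal)" by (subst dyadic_eq_iff) simp
    then show ?thesis
      using that(1) Suc.IH[of i] surreal_of_real_dyadic[of i n, where 'o = 'o] dyadicI[of i n]
      by (metis image_eqI)
  qed
  show ?case
  proof (cases "even k")
    case True
    then show ?thesis using even Suc.prems by blast
  next
    case False
    note c = is_cut_odd_dyadic[OF False, of "Suc n", where 'o = 'o]
    have b: "of_int (k - 1) / 2 ^ Suc n < (of_int k / 2 ^ Suc n :: 'o surreal)"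
      "of_int k / 2 ^ Suc n < (of_int (k + 1) / 2 ^ Suc n :: 'o surreal)"
      using is_cut_less[OF c] is_cut_greater[OF c] by auto
    from Suc.prems c consider "u \<le> of_int (k - 1) / 2 ^ Suc n" | "of_int (k + 1) / 2 ^ Suc n \<le> u"
      unfolding is_cut_def by blast
    then show ?thesis
    proof cases
      case 1
      show ?thesis
      proof (rule even)
        show "u = of_int (k - 1) / 2 ^ Suc n \<or> simpler u (of_int (k - 1) / 2 ^ Suc n)"
          by (rule simpler_between[OF Suc.prems]) (use 1 b(1) less_imp_le in blast)
      qed (use False in simp)
    next
      case 2
      show ?thesis
      proof (rule even)
        show "u = of_int (k + 1) / 2 ^ Suc n \<or> simpler u (of_int (k + 1) / 2 ^ Suc n)"
          by (rule simpler_between[OF Suc.prems]) (use 2 b(2) less_imp_le in blast)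
      qed (use False in simp)
    qed
  qed
qed

text \<open>Some dyadic \<open>d\<close> lies weakly between \<open>u\<close> and \<open>r\<close>,
  since \<open>u\<close> is outside the cut of \<open>r\<close>; by \<open>simpler_between\<close>,
  \<open>u\<close> is \<open>d\<close> or simpler than \<open>d\<close>.\<close>

lemma simpler_of_real:
  assumes u: "simpler u (surreal_of_real r :: 'o::ordinals surreal)"
  obtains d where "u = surreal_of_real d"
proof -
  have "(\<exists>l\<in>surreal_of_real ` {d \<in> dyadics. d < r}. u \<le> l) \<or>
    (\<exists>l\<in>surreal_of_real ` {d \<in> dyadics. r < d}. l \<le> u)"
    using u is_cut_of_real[of r, where 'o = 'o] unfolding is_cut_def by blast
  then obtain d where d: "d \<in> dyadics" "u \<le> surreal_of_real d \<and> d < r \<or> surreal_of_real d \<le> u \<and> r < d"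
    by blast
  then have "u = surreal_of_real d \<or> simpler u (surreal_of_real d)"
    by (intro simpler_between[OF u]) (auto simp: order_le_less)
  moreover obtain k n where "d = of_int k / 2 ^ n" using d(1) by (rule dyadicE)
  ultimately have "u \<in> range surreal_of_real"
    using simpler_dyadic[of u k n] unfolding surreal_of_real_dyadic[symmetric] by auto
  then show ?thesis using that by blast
qed


section \<open>The exponential of a real number\<close>

definition exp_sum :: "nat \<Rightarrow> real \<Rightarrow> real" where
  "exp_sum n t = (\<Sum>k\<le>n. t ^ k / fact k)"

lemma exp_poly_of_real:
  "exp_poly n (surreal_of_real t) = (surreal_of_real (exp_sum n t) :: 'o::ordinals surreal)"
proof (induction n)
  case 0
  show ?case by (simp add: exp_sum_def)
next
  case (Suc n)
  have "surreal_of_nat (fact (Suc n)) = (surreal_of_real (fact (Suc n)) :: 'o surreal)"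
    using surreal_of_real_of_nat[of "fact (Suc n)", where 'o = 'o]
    by (simp only: surreal_of_nat_eq of_nat_fact)
  then show ?case
    using Suc by (simp add: exp_sum_def surreal_of_real_add surreal_of_real_divide surreal_of_real_power
        surreal_of_real_mult del: fact_Suc)
qed

lemma exp_sum_tendsto: "(\<lambda>n. exp_sum n t) \<longlonglongrightarrow> exp t"
  using exp_converges[of t] unfolding sums_def_le exp_sum_def by (simp add: divide_inverse mult.commute)

lemma exp_sum_odd_tendsto: "(\<lambda>n. exp_sum (2 * n + 1) t) \<longlonglongrightarrow> exp t"
  by (rule filterlim_compose[OF exp_sum_tendsto filterlim_subseq]) (simp add: strict_mono_def)

text \<open>The Lagrange remainder has the sign of \<open>t ^ Suc n\<close>. This covers every
  \<open>n\<close> for \<open>t > 0\<close> and odd \<open>n\<close> for every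
  \<open>t \<noteq> 0\<close>, the two kinds of Taylor polynomial in the definition of the
  exponential.\<close>

lemma exp_sum_less:
  assumes "0 < t ^ Suc n" shows "exp_sum n t < exp t"
proof -
  obtain s where "exp t = (\<Sum>m<Suc n. t ^ m / fact m) + exp s / fact (Suc n) * t ^ Suc n"
    using Maclaurin_exp_le[of t "Suc n"] by blast
  moreover have "0 < exp s / fact (Suc n) * t ^ Suc n" using assms by (intro mult_pos_pos) auto
  ultimately show ?thesis by (simp only: exp_sum_def lessThan_Suc_atMost)
qed

lemma exp_sum_pos: "0 < t \<Longrightarrow> 0 < exp_sum n t"
  unfolding exp_sum_def by (intro sum_pos) auto

text \<open>By \<open>simpler_of_real\<close> and induction every member of the defining cut is a
  real number, and \<open>exp_sum_less\<close> puts it on the proper side of \<open>exp r\<close>.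
  Conversely, the members coming from the single option 0 already converge to \<open>exp r\<close>,
  so they pass every dyadic option of \<open>exp r\<close>.\<close>

lemma surreal_exp_of_real: "surreal_exp (surreal_of_real r) = (surreal_of_real (exp r) :: 'o::ordinals surreal)"
proof (induction "birthday (surreal_of_real r :: 'o surreal)" arbitrary: r rule: less_induct)
  case less
  let ?x = "surreal_of_real r :: 'o surreal"
  show ?case
  proof (cases "r = 0")
    case True
    \<comment> \<open>Since 0 has no options, the defining cut is the one that defines 1.\<close>
    then show ?thesis by (simp add: surreal_exp.simps[of 0] one_surreal_def)
  next
    case False
    have IH: "surreal_exp (surreal_of_real s) = (surreal_of_real (exp s) :: 'o surreal)"
      if "simpler (surreal_of_real s) ?x" for s
      using less that simpler_birthday by blast
    have mult: "surreal_exp (surreal_of_real s) * exp_poly n (?x - surreal_of_real s) =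
        surreal_of_real (exp s * exp_sum n (r - s))" if "simpler (surreal_of_real s) ?x" for s n
      by (simp add: IH[OF that] surreal_of_real_mult exp_poly_of_real flip: surreal_of_real_diff)
    have div: "surreal_exp (surreal_of_real s) / exp_poly n (surreal_of_real s - ?x) =
        surreal_of_real (exp s / exp_sum n (s - r))" if "simpler (surreal_of_real s) ?x" for s n
      by (simp add: IH[OF that] surreal_of_real_divide exp_poly_of_real flip: surreal_of_real_diff)
    have pos: "0 < exp_poly n (surreal_of_real s - surreal_of_real t :: 'o surreal) \<longleftrightarrow> 0 < exp_sum n (s - t)" for s t n
      using surreal_of_real_less_iff[of 0, where 'o = 'o]
      by (simp add: exp_poly_of_real flip: surreal_of_real_diff)
    let ?L = "{0}
          \<union> (\<Union>u\<in>lopt ?x. {surreal_exp u * exp_poly n (?x - u) | n. True})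
          \<union> (\<Union>v\<in>ropt ?x. {surreal_exp v * exp_poly (2 * n + 1) (?x - v) | n.
                           0 < exp_poly (2 * n + 1) (?x - v)})"
    let ?R = "(\<Union>v\<in>ropt ?x. {surreal_exp v / exp_poly n (v - ?x) | n. True})
          \<union> (\<Union>u\<in>lopt ?x. {surreal_exp u / exp_poly (2 * n + 1) (u - ?x) | n.
                           0 < exp_poly (2 * n + 1) (u - ?x)})"
    have L1: "surreal_of_real (exp s * exp_sum n (r - s)) \<in> ?L"
      if "simpler (surreal_of_real s) ?x" "s < r" for s n
      unfolding mult[OF that(1), symmetric] using that by (auto simp: lopt_def)
    have L2: "surreal_of_real (exp s * exp_sum (2 * n + 1) (r - s)) \<in> ?L"
      if "simpler (surreal_of_real s) ?x" "r < s" "0 < exp_sum (2 * n + 1) (r - s)" for s n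
      unfolding mult[OF that(1), symmetric] using that(1,2) that(3)[folded pos] by (auto simp: ropt_def)
    have R1: "surreal_of_real (exp s / exp_sum n (s - r)) \<in> ?R"
      if "simpler (surreal_of_real s) ?x" "r < s" for s n
      unfolding div[OF that(1), symmetric] using that by (auto simp: ropt_def)
    have R2: "surreal_of_real (exp s / exp_sum (2 * n + 1) (s - r)) \<in> ?R"
      if "simpler (surreal_of_real s) ?x" "s < r" "0 < exp_sum (2 * n + 1) (s - r)" for s n
      unfolding div[OF that(1), symmetric] using that(1,2) that(3)[folded pos] by (auto simp: lopt_def)
    have odd_less: "exp_sum (2 * n + 1) t < exp t" if "t \<noteq> 0" for n t
      by (rule exp_sum_less, unfold zero_less_power_eq) (use that in simp)
    have mult_less: "exp s * exp_sum n (r - s) < exp r" if "exp_sum n (r - s) < exp (r - s)" for s n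
      using that by (simp add: exp_diff field_simps)
    have less_div: "exp r < exp s / exp_sum n (s - r)"
      if "exp_sum n (s - r) < exp (s - r)" "0 < exp_sum n (s - r)" for s n
      using that by (simp add: exp_diff field_simps)
    have lim: "(\<lambda>n. exp s * exp_sum n (r - s)) \<longlonglongrightarrow> exp r"
      "(\<lambda>n. exp s * exp_sum (2 * n + 1) (r - s)) \<longlonglongrightarrow> exp r"
      "(\<lambda>n. exp s / exp_sum n (s - r)) \<longlonglongrightarrow> exp r"
      "(\<lambda>n. exp s / exp_sum (2 * n + 1) (s - r)) \<longlonglongrightarrow> exp r" for s
      using tendsto_mult[OF tendsto_const[of "exp s"] exp_sum_tendsto[of "r - s"]]
        tendsto_mult[OF tendsto_const[of "exp s"] exp_sum_odd_tendsto[of "r - s"]]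
        tendsto_divide[OF tendsto_const[of "exp s"] exp_sum_tendsto[of "s - r"]]
        tendsto_divide[OF tendsto_const[of "exp s"] exp_sum_odd_tendsto[of "s - r"]]
      by (simp_all add: exp_diff)
    have "?x \<noteq> 0" using False surreal_of_real_eq_iff[of r 0, where 'o = 'o] by simp
    \<comment> \<open>The empty sign expansion is an initial segment of every other one, so 0 is a
      left or a right option of \<open>r\<close> according to the sign of \<open>r\<close>.\<close>
    then have zero: "simpler (surreal_of_real 0) ?x" using zero_simpler by simp
    have cut: "is_cut (surreal_of_real (exp r)) ?L ?R"
    proof (rule is_cut_replace[OF is_cut_of_real])
      fix l assume "l \<in> ?L"
      then consider "l = 0"
        | u n where "u \<in> lopt ?x" "l = surreal_exp u * exp_poly n (?x - u)"
        | v n where "v \<in> ropt ?x" "l = surreal_exp v * exp_poly (2 * n + 1) (?x - v)" by blast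
      then show "l < surreal_of_real (exp r)"
      proof cases
        case 1
        then show ?thesis using surreal_of_real_less_iff[of 0 "exp r", where 'o = 'o] by simp
      next
        case 2
        then obtain s where s: "u = surreal_of_real s" using lopt_simpler simpler_of_real by metis
        with 2 have *: "simpler (surreal_of_real s) ?x" "s < r" by (auto simp: lopt_def)
        then have "exp s * exp_sum n (r - s) < exp r" by (intro mult_less exp_sum_less) simp
        then show ?thesis unfolding 2(2) s mult[OF *(1)] by simp
      next
        case 3
        then obtain s where s: "v = surreal_of_real s" using ropt_simpler simpler_of_real by metis
        with 3 have *: "simpler (surreal_of_real s) ?x" "r < s" by (auto simp: ropt_def)
        then have "exp s * exp_sum (2 * n + 1) (r - s) < exp r" by (intro mult_less odd_less) simp
        then show ?thesis unfolding 3(2) s mult[OF *(1)] by simp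
      qed
    next
      fix l assume "l \<in> ?R"
      then consider v n where "v \<in> ropt ?x" "l = surreal_exp v / exp_poly n (v - ?x)"
        | u n where "u \<in> lopt ?x" "l = surreal_exp u / exp_poly (2 * n + 1) (u - ?x)"
            "0 < exp_poly (2 * n + 1) (u - ?x)" by blast
      then show "surreal_of_real (exp r) < l"
      proof cases
        case 1
        then obtain s where s: "v = surreal_of_real s" using ropt_simpler simpler_of_real by metis
        with 1 have *: "simpler (surreal_of_real s) ?x" "r < s" by (auto simp: ropt_def)
        then have "exp r < exp s / exp_sum n (s - r)"
          by (intro less_div exp_sum_less exp_sum_pos) simp_all
        then show ?thesis unfolding 1(2) s div[OF *(1)] by simp
      next
        case 2
        then obtain s where s: "u = surreal_of_real s" using lopt_simpler simpler_of_real by metis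
        with 2 have *: "simpler (surreal_of_real s) ?x" "s < r" by (auto simp: lopt_def)
        have "0 < exp_sum (2 * n + 1) (s - r)" using 2(3) unfolding s pos .
        then have "exp r < exp s / exp_sum (2 * n + 1) (s - r)"
          using * by (intro less_div odd_less) simp_all
        then show ?thesis unfolding 2(2) s div[OF *(1)] by simp
      qed
    next
      fix a :: "'o surreal" assume "a \<in> surreal_of_real ` {d \<in> dyadics. d < exp r}"
      then obtain q where q: "a = surreal_of_real q" "q < exp r" by blast
      show "\<exists>l\<in>?L. a \<le> l"
      proof (cases "0 < r")
        case True
        have "\<forall>\<^sub>F n in sequentially. q < exp 0 * exp_sum n (r - 0)"
          using order_tendstoD(1)[OF lim(1) q(2)] .
        then obtain n where "q < exp 0 * exp_sum n (r - 0)"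
          using eventually_happens' sequentially_bot by blast
        then have "a \<le> surreal_of_real (exp 0 * exp_sum n (r - 0))"
          unfolding q(1) by (intro less_imp_le) (simp only: surreal_of_real_less_iff)
        then show ?thesis by (rule bexI[OF _ L1[OF zero True]])
      next
        case neg: False
        \<comment> \<open>Exceeding 0 as well as \<open>q\<close> guarantees the positivity under
          which this term is present in the cut.\<close>
        have "\<forall>\<^sub>F n in sequentially. max 0 q < exp 0 * exp_sum (2 * n + 1) (r - 0)"
          by (rule order_tendstoD(1)[OF lim(2)]) (use q in simp)
        then obtain n where n: "max 0 q < exp 0 * exp_sum (2 * n + 1) (r - 0)"
          using eventually_happens' sequentially_bot by blast
        then have "0 < exp_sum (2 * n + 1) (r - 0)" by simp
        moreover have "a \<le> surreal_of_real (exp 0 * exp_sum (2 * n + 1) (r - 0))"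
          unfolding q(1) by (intro less_imp_le) (use n in \<open>simp only: surreal_of_real_less_iff max_less_iff_conj\<close>)
        moreover have "r < 0" using neg False by simp
        ultimately show ?thesis by (intro bexI[OF _ L2[OF zero]])
      qed
    next
      fix a :: "'o surreal" assume "a \<in> surreal_of_real ` {d \<in> dyadics. exp r < d}"
      then obtain q where q: "a = surreal_of_real q" "exp r < q" by blast
      show "\<exists>l\<in>?R. l \<le> a"
      proof (cases "r < 0")
        case True
        have "\<forall>\<^sub>F n in sequentially. exp 0 / exp_sum n (0 - r) < q"
          using order_tendstoD(2)[OF lim(3) q(2)] .
        then obtain n where "exp 0 / exp_sum n (0 - r) < q"
          using eventually_happens' sequentially_bot by blast
        then have "surreal_of_real (exp 0 / exp_sum n (0 - r)) \<le> a"
          unfolding q(1) by (intro less_imp_le) (simp only: surreal_of_real_less_iff)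
        then show ?thesis by (rule bexI[OF _ R1[OF zero True]])
      next
        case nonneg: False
        have "\<forall>\<^sub>F n in sequentially. exp 0 / exp_sum (2 * n + 1) (0 - r) < q"
          using order_tendstoD(2)[OF lim(4) q(2)] .
        \<comment> \<open>The Taylor sums tend to the positive number \<open>exp (0 - r)\<close>, so
          the side condition of these terms holds eventually.\<close>
        moreover have "\<forall>\<^sub>F n in sequentially. 0 < exp_sum (2 * n + 1) (0 - r)"
          by (rule order_tendstoD(1)[OF exp_sum_odd_tendsto]) simp
        ultimately have "\<forall>\<^sub>F n in sequentially.
            exp 0 / exp_sum (2 * n + 1) (0 - r) < q \<and> 0 < exp_sum (2 * n + 1) (0 - r)"
          by (rule eventually_conj)
        then obtain n where n: "exp 0 / exp_sum (2 * n + 1) (0 - r) < q" "0 < exp_sum (2 * n + 1) (0 - r)"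
          using eventually_happens' sequentially_bot by blast
        have "surreal_of_real (exp 0 / exp_sum (2 * n + 1) (0 - r)) \<le> a"
          unfolding q(1) by (intro less_imp_le) (use n(1) in \<open>simp only: surreal_of_real_less_iff\<close>)
        moreover have "0 < r" using nonneg False by simp
        ultimately show ?thesis using n(2) by (intro bexI[OF _ R2[OF zero]])
      qed
    qed
    show ?thesis unfolding surreal_exp.simps[of ?x] by (rule cut_eqI[OF cut])
  qed
qed


section \<open>Many extension operators\<close>

abbreviation monomial :: "nat \<Rightarrow> real \<Rightarrow> real" where
  "monomial n \<equiv> \<lambda>x. x ^ n"

definition point :: "real \<Rightarrow> real \<Rightarrow> real" where
  "point r = (\<lambda>x. if x = r then 1 else 0)"

definition special :: "(real \<Rightarrow> real) set" where
  "special = range monomial \<union> {exp} \<union> range point"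

lemma inj_monomial: "inj monomial"
proof (rule injI)
  fix m n assume "monomial m = monomial n"
  from fun_cong[OF this, of 2] show "m = n" by simp
qed

lemma inj_point: "inj point"
proof (rule injI)
  fix r s assume "point r = point s"
  from fun_cong[OF this, of r] show "r = s" by (simp add: point_def split: if_splits)
qed

lemma monomial_neq_exp: "monomial n \<noteq> exp"
proof
  assume *: "monomial n = exp"
  from fun_cong[OF *, of 0] have "n = 0" by (cases n) auto
  with fun_cong[OF *, of 1] show False by simp
qed

lemma point_neq: "point r \<noteq> monomial n" "point r \<noteq> exp"
proof -
  \<comment> \<open>The argument is positive and different from \<open>r\<close>, so the indicator
    vanishes there while monomials and the exponential are positive.\<close>
  have "point r (\<bar>r\<bar> + 1) = 0" by (auto simp: point_def)
  then show "point r \<noteq> monomial n" "point r \<noteq> exp"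
    using exp_gt_zero[of "\<bar>r\<bar> + 1"] zero_less_power[of "\<bar>r\<bar> + 1" n] by (auto dest: fun_cong[of _ _ "\<bar>r\<bar> + 1"])
qed

text \<open>The three kinds of functions are told apart by their growth: off a finite set the points
  vanish, and the exponential function dominates all monomials.\<close>

lemma exp_polynomial_points_independent:
  fixes a :: "nat \<Rightarrow> real" and b :: "real \<Rightarrow> real"
  assumes "finite R" and zero: "\<And>x. (\<Sum>n\<le>m. a n * x ^ n) + c * exp x + (\<Sum>r\<in>R. b r * point r x) = 0"
  shows "c = 0" "\<forall>n\<le>m. a n = 0" "\<forall>r\<in>R. b r = 0"
proof -
  have point: "(\<Sum>r\<in>R. b r * point r x) = (if x \<in> R then b x else 0)" for x
    using \<open>finite R\<close> by (simp add: point_def sum.delta' if_distrib[of "(*) _"] cong: if_cong)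
  have lim: "((\<lambda>x. \<Sum>n\<le>m. a n * (x ^ n / exp x)) \<longlongrightarrow> (\<Sum>n\<le>m. a n * 0)) at_top"
    by (intro tendsto_sum tendsto_mult tendsto_const tendsto_power_div_exp_0)
  have "\<forall>\<^sub>F x in at_top. \<forall>r\<in>R. r < x"
    using \<open>finite R\<close> by (simp add: eventually_ball_finite_distrib eventually_gt_at_top)
  \<comment> \<open>Beyond the finite set, division by \<open>exp x\<close> makes the polynomial
    part equal to the constant \<open>- c\<close>, while it tends to 0.\<close>
  then have "\<forall>\<^sub>F x in at_top. (\<Sum>n\<le>m. a n * (x ^ n / exp x)) = - c"
  proof eventually_elim
    case (elim x)
    then have "x \<notin> R" by auto
    then have "(\<Sum>n\<le>m. a n * x ^ n) = - c * exp x" using zero[of x] by (simp add: point)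
    then have "(\<Sum>n\<le>m. a n * x ^ n) / exp x = - c" by simp
    then show ?case by (simp add: sum_divide_distrib)
  qed
  from tendsto_unique[OF _ lim tendsto_eventually[OF this]] show c: "c = 0" by simp
  \<comment> \<open>With \<open>c = 0\<close> the polynomial vanishes off a finite set, hence at
    infinitely many places.\<close>
  have "- R \<subseteq> {x. (\<Sum>n\<le>m. a n * x ^ n) = 0}"
  proof
    show "x \<in> {x. (\<Sum>n\<le>m. a n * x ^ n) = 0}" if "x \<in> - R" for x
      using zero[of x] that by (simp add: c point)
  qed
  moreover have "infinite (- R)"
    using \<open>finite R\<close> infinite_UNIV_char_0[where 'a = real] by (simp add: finite_compl)
  ultimately have "infinite {x. (\<Sum>n\<le>m. a n * x ^ n) = 0}" using finite_subset by blast
  then show a: "\<forall>n\<le>m. a n = 0" unfolding polyfun_finite_roots by blast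
  show "\<forall>r\<in>R. b r = 0"
  proof
    show "b r = 0" if "r \<in> R" for r using zero[of r] that a by (simp add: c point)
  qed
qed

text \<open>Both sides as real vector spaces, the scalars acting on surreals through the embedding.
  This provides \<open>construct\<close>, which extends an assignment on a linearly independent set
  to a linear map on the whole space.\<close>

interpretation surreal_vs: vector_space_pair
  "\<lambda>c f x. c * f x :: real" "\<lambda>c z. surreal_of_real c * z :: 'o::ordinals surreal"
  by unfold_locales
    (auto simp: fun_eq_iff algebra_simps surreal_of_real_add surreal_of_real_mult)

lemma independent_special: "surreal_vs.vs1.independent special"
  unfolding surreal_vs.vs1.independent_explicit_module
proof (intro allI impI)
  fix t and u :: "(real \<Rightarrow> real) \<Rightarrow> real" and v
  assume t: "finite t" "t \<subseteq> special" and sum: "(\<Sum>v\<in>t. (\<lambda>x. u v * v x)) = 0" and "v \<in> t"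
  define N where "N = {n. monomial n \<in> t}"
  define R where "R = {r. point r \<in> t}"
  have fin: "finite N" "finite R"
    using finite_vimageI[OF t(1) inj_monomial] finite_vimageI[OF t(1) inj_point]
    by (simp_all add: N_def R_def vimage_def)
  obtain m where m: "N \<subseteq> {..m}" using finite_nat_iff_bounded_le[of N] fin by blast
  have t_eq: "t = (monomial ` N \<union> t \<inter> {exp}) \<union> point ` R"
    using t(2) by (auto simp: N_def R_def special_def)
  \<comment> \<open>Padding with zeros turns the finite set of exponents into a full range, so that
    the relation contains an ordinary polynomial.\<close>
  define a where "a n = (if n \<in> N then u (monomial n) else 0)" for n
  define c where "c = (if exp \<in> t then u exp else 0)"
  have zero: "(\<Sum>n\<le>m. a n * x ^ n) + c * exp x + (\<Sum>r\<in>R. u (point r) * point r x) = 0" for x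
  proof -
    have "0 = (\<Sum>v\<in>t. u v * v x)"
    proof -
      have "(\<Sum>v\<in>t'. (\<lambda>x. u v * v x)) x = (\<Sum>v\<in>t'. u v * v x)" for t'
        by (induction t' rule: infinite_finite_induct) simp_all
      then show ?thesis using fun_cong[OF sum, of x] by simp
    qed
    also have "\<dots> = (\<Sum>v\<in>monomial ` N \<union> t \<inter> {exp}. u v * v x) + (\<Sum>v\<in>point ` R. u v * v x)"
      by (subst t_eq, rule sum.union_disjoint) (use fin point_neq in auto)
    also have "(\<Sum>v\<in>monomial ` N \<union> t \<inter> {exp}. u v * v x) =
        (\<Sum>v\<in>monomial ` N. u v * v x) + (\<Sum>v\<in>t \<inter> {exp}. u v * v x)"
      by (rule sum.union_disjoint) (use fin monomial_neq_exp in auto)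
    also have "(\<Sum>v\<in>t \<inter> {exp}. u v * v x) = c * exp x" by (simp add: c_def)
    also have "(\<Sum>v\<in>monomial ` N. u v * v x) = (\<Sum>n\<in>N. u (monomial n) * x ^ n)"
      by (subst sum.reindex[OF inj_on_subset[OF inj_monomial]]) simp_all
    also have "\<dots> = (\<Sum>n\<le>m. a n * x ^ n)"
      using m by (intro sum.mono_neutral_cong_left) (auto simp: a_def)
    also have "(\<Sum>v\<in>point ` R. u v * v x) = (\<Sum>r\<in>R. u (point r) * point r x)"
      by (subst sum.reindex[OF inj_on_subset[OF inj_point]]) simp_all
    finally show ?thesis by simp
  qed
  note ind = exp_polynomial_points_independent[OF fin(2) zero]
  from \<open>v \<in> t\<close> t_eq consider n where "n \<in> N" "v = monomial n" | "v = exp" | r where "r \<in> R" "v = point r"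
    by blast
  then show "u v = 0"
  proof cases
    case 1
    then have "a n = 0" using ind(2) m by auto
    then show ?thesis using 1 by (simp add: a_def)
  next
    case 2
    then show ?thesis using ind(1) \<open>v \<in> t\<close> by (simp add: c_def)
  next
    case 3
    then show ?thesis using ind(3) by simp
  qed
qed

section \<open>Construction of the operators\<close>

lemma inj_surreal_of_real: "inj surreal_of_real"
  by (rule injI) simp

text \<open>The witness is omega: it exceeds all natural numbers, as no real number does.\<close>

lemma ex_not_real: "\<exists>x :: 'o::ordinals surreal. x \<notin> range surreal_of_real"
proof -
  have c: "is_cut (cut (range of_nat) {}) (range of_nat) ({} :: 'o surreal set)"
    by (rule is_cut_cut) (auto intro: small_countable)
  have "cut (range of_nat) {} \<noteq> (surreal_of_real r :: 'o surreal)" for r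
  proof
    assume *: "cut (range of_nat) {} = (surreal_of_real r :: 'o surreal)"
    obtain n where "r < of_nat n" using reals_Archimedean2 by blast
    then have "surreal_of_real r < (surreal_of_real (of_nat n) :: 'o surreal)" by simp
    moreover have "of_nat n < (surreal_of_real r :: 'o surreal)"
      using is_cut_less[OF c] unfolding * by blast
    ultimately show False by (simp add: surreal_of_real_of_nat)
  qed
  then show ?thesis by blast
qed

text \<open>The monomials and the exponential have forced values; \<open>A\<close> encodes the free
  choice between 0 and 1 at each indicator function.\<close>

definition basis_value :: "real set \<Rightarrow> 'o::ordinals surreal \<Rightarrow> (real \<Rightarrow> real) \<Rightarrow> 'o surreal" where
  "basis_value A x f =
     (if f \<in> range monomial then x ^ inv monomial f
      else if f = exp then surreal_exp x
      else if f \<in> point ` A then 1 else 0)"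

text \<open>At a real argument the value is forced at every function, not just at the basis
  functions, so it is evaluation, itself linear in \<open>f\<close>. A linear map from
  \<open>construct\<close> would be controlled only on the span of \<open>special\<close>.\<close>

definition ext_op :: "real set \<Rightarrow> (real \<Rightarrow> real) \<Rightarrow> 'o::ordinals surreal \<Rightarrow> 'o surreal" where
  "ext_op A f x =
     (if x \<in> range surreal_of_real then surreal_of_real (f (inv surreal_of_real x))
      else surreal_vs.construct special (basis_value A x) f)"

lemma ext_op_of_real: "ext_op A f (surreal_of_real r) = surreal_of_real (f r)"
  by (simp add: ext_op_def inv_f_f[OF inj_surreal_of_real])

lemma ext_op_special:
  assumes "f \<in> special" "x \<notin> range surreal_of_real"
  shows "ext_op A f x = basis_value A x f"
  using assms by (simp add: ext_op_def surreal_vs.construct_basis[OF independent_special])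

lemma extension_operator_ext_op: "extension_operator UNIV (ext_op A :: _ \<Rightarrow> 'o::ordinals surreal \<Rightarrow> 'o surreal)"
proof -
  have lin: "module_hom (\<lambda>c f x. c * f x) (\<lambda>c z. surreal_of_real c * z)
      (surreal_vs.construct special (basis_value A x))" for x :: "'o surreal"
    using surreal_vs.linear_construct[OF independent_special]
    by (simp only: module_hom_iff_linear)
  have scale: "ext_op A (\<lambda>y. c * f y) x = surreal_of_real c * ext_op A f x" for c f and x :: "'o surreal"
    using module_hom.scale[OF lin, of x c f] by (auto simp: ext_op_def surreal_of_real_mult)
  have add: "ext_op A (\<lambda>y. f y + g y) x = ext_op A f x + ext_op A g x" for f g and x :: "'o surreal"
    using module_hom.add[OF lin, of x f g] by (auto simp: ext_op_def surreal_of_real_add plus_fun_def)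
  have mono: "ext_op A (monomial n) x = x ^ n" for n and x :: "'o surreal"
  proof (cases "x \<in> range surreal_of_real")
    case True
    then show ?thesis by (auto simp: ext_op_of_real surreal_of_real_power)
  next
    case False
    have "monomial n \<in> special" by (auto simp: special_def)
    from ext_op_special[OF this False] show ?thesis
      using inv_f_f[OF inj_monomial, of n] by (simp add: basis_value_def)
  qed
  have exp: "ext_op A exp x = surreal_exp x" for x :: "'o surreal"
  proof (cases "x \<in> range surreal_of_real")
    case True
    then show ?thesis by (auto simp: ext_op_of_real surreal_exp_of_real)
  next
    case False
    have "exp \<in> special" by (auto simp: special_def)
    moreover have "exp \<notin> range monomial" using monomial_neq_exp by (metis imageE)
    ultimately show ?thesis by (simp add: ext_op_special[OF _ False] basis_value_def)
  qed
  show ?thesis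
    unfolding extension_operator_def extends_def
    using scale add mono exp by (auto simp: ext_op_of_real fun_eq_iff)
qed

text \<open>At one fixed non-real number, the value at \<open>point r\<close> reveals whether
  \<open>r\<close> belongs to the set.\<close>

lemma inj_ext_op: "inj (ext_op :: real set \<Rightarrow> (real \<Rightarrow> real) \<Rightarrow> 'o::ordinals surreal \<Rightarrow> 'o surreal)"
proof (rule injI, rule set_eqI)
  fix A B r
  assume eq: "ext_op A = (ext_op B :: _ \<Rightarrow> 'o surreal \<Rightarrow> 'o surreal)"
  obtain x :: "'o surreal" where x: "x \<notin> range surreal_of_real" using ex_not_real by blast
  have s: "point r \<in> special" by (auto simp: special_def)
  have *: "ext_op C (point r) x = (if r \<in> C then 1 else 0)" for C
    unfolding ext_op_special[OF s x] basis_value_def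
    using point_neq inj_point by (auto simp: inj_image_mem_iff)
  from fun_cong[OF fun_cong[OF eq, of "point r"], of x] show "r \<in> A \<longleftrightarrow> r \<in> B"
    unfolding * by (simp split: if_splits)
qed

theorem theorem7:
  "\<exists>S :: ((real \<Rightarrow> real) \<Rightarrow> 'o::ordinals surreal \<Rightarrow> 'o surreal) set.
     S \<subseteq> {E. extension_operator UNIV E} \<and> S \<approx> Pow (UNIV :: real set)"
proof (intro exI conjI)
  show "range ext_op \<subseteq> {E. extension_operator UNIV (E :: _ \<Rightarrow> 'o surreal \<Rightarrow> 'o surreal)}"
    using extension_operator_ext_op by blast
  show "range (ext_op :: _ \<Rightarrow> _ \<Rightarrow> 'o surreal \<Rightarrow> 'o surreal) \<approx> Pow (UNIV :: real set)"
    using inj_on_image_eqpoll_self[OF inj_ext_op] by simp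
qed

end
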